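(* Let $f^*:[0,T]\times\Omega\to K^*_+$ be a measurable process, let $\Theta:[0,T]^2\to\mathcal{L}^+(X)$ be strongly continuous (i.e. $(u,r)\mapsto\Theta(u,r)\mathbf{y}$ is continuous for each $\mathbf{y}\in X$), and let $q$ be a finite nonnegative measure on $([0,T],\mathcal{B}([0,T]))$. Then for any $\nu\in\mathcal{S}$ we have $$\int_0^T\Big\langle f^*_t,\int_0^t\Theta(t,s)\,\mathrm{d}\nu_s\Big\rangle\,q(\mathrm{d}t)=\int_0^T\Big\langle\int_s^T\Theta^*(t,s)f^*_t\,q(\mathrm{d}t),\ \mathrm{d}\nu_s\Big\rangle$$ (as an equality in $[0,\infty]$, $\mathsf{P}$-a.s.), where $\Theta^*(t,s)=(\Theta(t,s))^*$.
   Context: **Spaces.** $(D,\mathcal{M},\mu)$ is a measure space, $p\in(1,\infty)$, $X=L^p(D,\mathcal{M},\mu)$, $X^*=L^{p^*}(D,\mathcal{M},\mu)$ with $p^*=p/(p-1)$, $\langle v^*,v\rangle=\int_Dv^*v\,\mathrm{d}\mu$; order is pointwise a.e. $K_+=\{v\in X:v\ge0\}$, $K_+^*=\{v^*\in X^*:v^*\ge0\}$. $\mathcal{L}^+(X)$ is the set of bounded linear $P:X\to X$ with $f\ge0\Rightarrow Pf\ge0$. **Probability.** $T\in(0,\infty]$ (if $T=\infty$, intervals $[s,T]$ mean $[s,\infty)$). $(\Omega,\mathcal{F},\mathbb{F}=(\mathcal{F}_t)_{t\in[0,T]},\mathsf{P})$ is a filtered probability space satisfying the usual conditions. **Controls.**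 $\mathcal{S}$ is the set of $\mathbb{F}$-adapted processes $\nu:\Omega\times[0,T]\to K_+$ such that $t\mapsto\nu_t$ is nondecreasing and right-continuous. One sets $\nu_{0^-}:=\mathbf{0}$ and identifies $\nu$ with the (random) countably additive $K_+$-valued vector measure $\nu([s,t])=\nu_t-\nu_{s^-}$ (with mass $\nu_0$ at time $0$), which is of finite variation (on compact subintervals of $[0,T]$). $|\nu|$ is its variation measure and $\rho$ its $K_+$-valued Bochner measurable density: $\mathrm{d}\nu=\rho\,\mathrm{d}|\nu|$. **Integrals.** $\int_0^t\langle g^*_s,\mathrm{d}\nu_s\rangle:=\int_{[0,t]}\langle g^*_s,\rho_s\rangle\,\mathrm{d}|\nu|_s\in[0,\infty]$ for nonnegative $g^*$, and $\int_0^t\Theta(t,s)\,\mathrm{d}\nu_s:=\int_{[0,t]}\Theta(t,s)\rho_s\,\mathrm{d}|\nu|_s$ (Bochner integral in $X$). The integral $\int_s^T\Theta^*(t,s)f^*_t\,q(\mathrm{d}t)$ of a $K^*_+$-valued integrand is taken pointwise in $x\in D$ with values in $[0,\infty]$, so that $\langle\int_s^T\Theta^*(t,s)f^*_t\,q(\mathrm{d}t),v\rangle=\int_{[s,T]}\langle\Theta^*(t,s)f^*_t,v\rangle\,q(\mathrm{d}t)\in[0,\infty]$ for $v\in K_+$. *)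

theory Defs
  imports "HOL-Probability.Probability"
begin

section \<open>The spaces \<open>L\<^sup>p\<close>\<close>

text \<open>
  An element of \<open>L\<^sup>p(M)\<close> is given by a representative, a measurable real function whose \<open>p\<close>-th
  power is integrable.  Equality and order of elements are equality and order almost everywhere.
  The norm below is a seminorm on representatives that vanishes exactly on the null functions.
\<close>

definition Lp_space :: "'d measure \<Rightarrow> real \<Rightarrow> ('d \<Rightarrow> real) set" where
  "Lp_space M p = {v \<in> borel_measurable M. integrable M (\<lambda>x. \<bar>v x\<bar> powr p)}"

definition Lp_norm :: "'d measure \<Rightarrow> real \<Rightarrow> ('d \<Rightarrow> real) \<Rightarrow> real" where
  "Lp_norm M p v = (\<integral>x. \<bar>v x\<bar> powr p \<partial>M) powr (1 / p)"

definition Lp_dist :: "'d measure \<Rightarrow> real \<Rightarrow> ('d \<Rightarrow> real) \<Rightarrow> ('d \<Rightarrow> real) \<Rightarrow> real" where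
  "Lp_dist M p u v = Lp_norm M p (\<lambda>x. u x - v x)"

definition Lp_cone :: "'d measure \<Rightarrow> real \<Rightarrow> ('d \<Rightarrow> real) set" where
  "Lp_cone M p = {v \<in> Lp_space M p. AE x in M. 0 \<le> v x}"

definition conj_exp :: "real \<Rightarrow> real" where
  "conj_exp p = p / (p - 1)"

definition Lp_pairing :: "'d measure \<Rightarrow> ('d \<Rightarrow> real) \<Rightarrow> ('d \<Rightarrow> real) \<Rightarrow> real" where
  "Lp_pairing M g v = (\<integral>x. g x * v x \<partial>M)"

text \<open>The same pairing, with values in \<open>[0,\<infinity>]\<close>, of an extended nonnegative function with an
  element of the positive cone.\<close>

definition Lp_pairing_ext :: "'d measure \<Rightarrow> ('d \<Rightarrow> ennreal) \<Rightarrow> ('d \<Rightarrow> real) \<Rightarrow> ennreal" where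
  "Lp_pairing_ext M h v = (\<integral>\<^sup>+x. h x * ennreal (v x) \<partial>M)"

definition Lp_open :: "'d measure \<Rightarrow> real \<Rightarrow> ('d \<Rightarrow> real) set \<Rightarrow> bool" where
  "Lp_open M p U \<longleftrightarrow> U \<subseteq> Lp_space M p \<and>
     (\<forall>u\<in>U. \<exists>e>0. \<forall>v\<in>Lp_space M p. Lp_dist M p v u < e \<longrightarrow> v \<in> U)"

definition Lp_borel :: "'d measure \<Rightarrow> real \<Rightarrow> ('d \<Rightarrow> real) measure" where
  "Lp_borel M p = sigma (Lp_space M p) {U. Lp_open M p U}"


section \<open>Positive bounded operators and adjoints\<close>

text \<open>Linearity and boundedness force an operator to respect equality almost everywhere.\<close>

definition Lp_positive_operator ::
  "'d measure \<Rightarrow> real \<Rightarrow> (('d \<Rightarrow> real) \<Rightarrow> ('d \<Rightarrow> real)) \<Rightarrow> bool" where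
  "Lp_positive_operator M p P \<longleftrightarrow>
     (\<forall>v\<in>Lp_space M p. P v \<in> Lp_space M p) \<and>
     (\<forall>a b. \<forall>u\<in>Lp_space M p. \<forall>v\<in>Lp_space M p.
        AE x in M. P (\<lambda>y. a * u y + b * v y) x = a * P u x + b * P v x) \<and>
     (\<exists>C. \<forall>v\<in>Lp_space M p. Lp_norm M p (P v) \<le> C * Lp_norm M p v) \<and>
     (\<forall>v\<in>Lp_cone M p. P v \<in> Lp_cone M p)"

definition Lp_adjoint ::
  "'d measure \<Rightarrow> real \<Rightarrow> (('d \<Rightarrow> real) \<Rightarrow> ('d \<Rightarrow> real)) \<Rightarrow> (('d \<Rightarrow> real) \<Rightarrow> ('d \<Rightarrow> real)) \<Rightarrow> bool" where
  "Lp_adjoint M p P Q \<longleftrightarrow>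
     (\<forall>g\<in>Lp_space M (conj_exp p). Q g \<in> Lp_space M (conj_exp p) \<and>
        (\<forall>v\<in>Lp_space M p. Lp_pairing M (Q g) v = Lp_pairing M g (P v)))"


section \<open>The Bochner integral of \<open>L\<^sup>p\<close>-valued functions\<close>

text \<open>
  The construction of \<open>has_bochner_integral\<close> is repeated for the seminormed space above.  The
  library's version is not applicable: \<open>L\<^sup>p(M)\<close> is not a type, and it need not be separable.
\<close>

definition Lp_strongly_measurable ::
  "'d measure \<Rightarrow> real \<Rightarrow> 's measure \<Rightarrow> ('s \<Rightarrow> 'd \<Rightarrow> real) \<Rightarrow> bool" where
  "Lp_strongly_measurable M p N G \<longleftrightarrow>
     (\<forall>s\<in>space N. G s \<in> Lp_space M p) \<and>
     (\<exists>S :: nat \<Rightarrow> 's \<Rightarrow> 'd \<Rightarrow> real.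
        (\<forall>i. simple_function N (S i) \<and> (\<forall>s\<in>space N. S i s \<in> Lp_space M p)) \<and>
        (AE s in N. (\<lambda>i. Lp_dist M p (G s) (S i s)) \<longlonglongrightarrow> 0))"

definition Lp_simple_integrable ::
  "'d measure \<Rightarrow> real \<Rightarrow> 's measure \<Rightarrow> ('s \<Rightarrow> 'd \<Rightarrow> real) \<Rightarrow> bool" where
  "Lp_simple_integrable M p N S \<longleftrightarrow>
     simple_function N S \<and> (\<forall>s\<in>space N. S s \<in> Lp_space M p) \<and>
     emeasure N {s\<in>space N. S s \<noteq> (\<lambda>_. 0)} \<noteq> \<infinity>"

definition Lp_simple_integral :: "'s measure \<Rightarrow> ('s \<Rightarrow> 'd \<Rightarrow> real) \<Rightarrow> 'd \<Rightarrow> real" where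
  "Lp_simple_integral N S = (\<lambda>x. \<Sum>y\<in>S ` space N. measure N {s\<in>space N. S s = y} * y x)"

definition has_Lp_integral ::
  "'d measure \<Rightarrow> real \<Rightarrow> 's measure \<Rightarrow> ('s \<Rightarrow> 'd \<Rightarrow> real) \<Rightarrow> ('d \<Rightarrow> real) \<Rightarrow> bool" where
  "has_Lp_integral M p N G v \<longleftrightarrow>
     Lp_strongly_measurable M p N G \<and> v \<in> Lp_space M p \<and>
     (\<exists>S :: nat \<Rightarrow> 's \<Rightarrow> 'd \<Rightarrow> real.
        (\<forall>i. Lp_simple_integrable M p N (S i)) \<and>
        (\<lambda>i. \<integral>\<^sup>+s. ennreal (Lp_dist M p (G s) (S i s)) \<partial>N) \<longlonglongrightarrow> 0 \<and>
        (\<lambda>i. Lp_dist M p (Lp_simple_integral N (S i)) v) \<longlonglongrightarrow> 0)"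

definition Lp_integral ::
  "'d measure \<Rightarrow> real \<Rightarrow> 's measure \<Rightarrow> ('s \<Rightarrow> 'd \<Rightarrow> real) \<Rightarrow> 'd \<Rightarrow> real" where
  "Lp_integral M p N G = (SOME v. has_Lp_integral M p N G v)"


section \<open>Time, filtrations and controls\<close>

text \<open>\<open>[0,T]\<close>, to be read as \<open>[0,\<infinity>)\<close> for \<open>T = \<infinity>\<close>.\<close>

definition time_set :: "ereal \<Rightarrow> real set" where
  "time_set T = {t. 0 \<le> t \<and> ereal t \<le> T}"

definition time_borel :: "ereal \<Rightarrow> real measure" where
  "time_borel T = restrict_space borel (time_set T)"

definition usual_filtration :: "ereal \<Rightarrow> 'w measure \<Rightarrow> (real \<Rightarrow> 'w measure) \<Rightarrow> bool" where
  "usual_filtration T P F \<longleftrightarrow>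
     (\<forall>t\<in>time_set T. subalgebra P (F t)) \<and>
     (\<forall>s\<in>time_set T. \<forall>t\<in>time_set T. s \<le> t \<longrightarrow> sets (F s) \<subseteq> sets (F t)) \<and>
     (\<forall>t\<in>time_set T. ereal t < T \<longrightarrow> sets (F t) = (\<Inter>u\<in>{u\<in>time_set T. t < u}. sets (F u))) \<and>
     (\<forall>N\<in>null_sets P. \<forall>A. A \<subseteq> N \<longrightarrow> A \<in> sets (F 0))"

definition controls ::
  "'d measure \<Rightarrow> real \<Rightarrow> ereal \<Rightarrow> 'w measure \<Rightarrow> (real \<Rightarrow> 'w measure) \<Rightarrow> ('w \<Rightarrow> real \<Rightarrow> 'd \<Rightarrow> real) set" where
  "controls M p T P F = {\<nu>.
     (\<forall>\<omega>\<in>space P. \<forall>t\<in>time_set T. \<nu> \<omega> t \<in> Lp_cone M p) \<and>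
     (\<forall>t\<in>time_set T. (\<lambda>\<omega>. \<nu> \<omega> t) \<in> measurable (F t) (Lp_borel M p)) \<and>
     (\<forall>\<omega>\<in>space P. \<forall>s\<in>time_set T. \<forall>t\<in>time_set T. s \<le> t \<longrightarrow> (AE x in M. \<nu> \<omega> s x \<le> \<nu> \<omega> t x)) \<and>
     (\<forall>\<omega>\<in>space P. \<forall>t\<in>time_set T.
        ((\<lambda>u. Lp_dist M p (\<nu> \<omega> u) (\<nu> \<omega> t)) \<longlongrightarrow> 0) (at t within (time_set T \<inter> {t<..})))}"


section \<open>The vector measure of a control, its variation and density\<close>

definition left_limit :: "'d measure \<Rightarrow> real \<Rightarrow> (real \<Rightarrow> 'd \<Rightarrow> real) \<Rightarrow> real \<Rightarrow> 'd \<Rightarrow> real" where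
  "left_limit M p n s =
     (if s = 0 then (\<lambda>_. 0)
      else (SOME v. v \<in> Lp_space M p \<and>
              ((\<lambda>u. Lp_dist M p (n u) v) \<longlongrightarrow> 0) (at s within {0..<s})))"

text \<open>
  For \<open>T = \<infinity>\<close> the vector measure is only defined on bounded sets, so it lives on the
  \<open>\<delta>\<close>-ring of bounded Borel subsets of the time set.
\<close>

definition bounded_borel :: "ereal \<Rightarrow> real set set" where
  "bounded_borel T = {A \<in> sets borel. bounded A \<and> A \<subseteq> time_set T}"

definition is_path_measure ::
  "'d measure \<Rightarrow> real \<Rightarrow> ereal \<Rightarrow> (real \<Rightarrow> 'd \<Rightarrow> real) \<Rightarrow> (real set \<Rightarrow> 'd \<Rightarrow> real) \<Rightarrow> bool" where
  "is_path_measure M p T n m \<longleftrightarrow>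
     (\<forall>A\<in>bounded_borel T. m A \<in> Lp_cone M p) \<and>
     (\<forall>B :: nat \<Rightarrow> real set. (\<forall>i. B i \<in> bounded_borel T) \<longrightarrow> disjoint_family B \<longrightarrow>
        bounded (\<Union>i. B i) \<longrightarrow>
        (\<lambda>k. Lp_dist M p (m (\<Union>i. B i)) (\<lambda>x. \<Sum>i<k. m (B i) x)) \<longlonglongrightarrow> 0) \<and>
     (\<forall>s\<in>time_set T. \<forall>t\<in>time_set T. s \<le> t \<longrightarrow>
        (AE x in M. m {s..t} x = n t x - left_limit M p n s x))"

definition path_measure ::
  "'d measure \<Rightarrow> real \<Rightarrow> ereal \<Rightarrow> (real \<Rightarrow> 'd \<Rightarrow> real) \<Rightarrow> real set \<Rightarrow> 'd \<Rightarrow> real" where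
  "path_measure M p T n = (SOME m. is_path_measure M p T n m)"

definition total_variation ::
  "'d measure \<Rightarrow> real \<Rightarrow> ereal \<Rightarrow> (real set \<Rightarrow> 'd \<Rightarrow> real) \<Rightarrow> real set \<Rightarrow> ennreal" where
  "total_variation M p T m A =
     (SUP C\<in>{C. finite C \<and> disjoint C \<and> C \<subseteq> bounded_borel T \<and> (\<forall>B\<in>C. B \<subseteq> A)}.
        \<Sum>B\<in>C. ennreal (Lp_norm M p (m B)))"

definition variation_measure ::
  "'d measure \<Rightarrow> real \<Rightarrow> ereal \<Rightarrow> (real \<Rightarrow> 'd \<Rightarrow> real) \<Rightarrow> real measure" where
  "variation_measure M p T n =
     measure_of (time_set T) (sets (time_borel T)) (total_variation M p T (path_measure M p T n))"

text \<open>
  For \<open>p > 1\<close> a nondecreasing right-continuous path need not have finite variation: with Lebesgue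
  measure on \<open>[0,1]\<close>, the path \<open>t \<mapsto> indicator {0..t}\<close> has infinite variation in \<open>L\<^sup>p\<close> on every
  nondegenerate interval.  Finite variation is therefore a condition of its own.
\<close>

definition finite_variation :: "'d measure \<Rightarrow> real \<Rightarrow> ereal \<Rightarrow> (real \<Rightarrow> 'd \<Rightarrow> real) \<Rightarrow> bool" where
  "finite_variation M p T n \<longleftrightarrow>
     (\<forall>t\<in>time_set T. total_variation M p T (path_measure M p T n) {0..t} < \<infinity>)"

definition variation_density ::
  "'d measure \<Rightarrow> real \<Rightarrow> ereal \<Rightarrow> (real \<Rightarrow> 'd \<Rightarrow> real) \<Rightarrow> (real \<Rightarrow> 'd \<Rightarrow> real) \<Rightarrow> bool" where
  "variation_density M p T n r \<longleftrightarrow>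
     (\<forall>s\<in>time_set T. r s \<in> Lp_cone M p) \<and>
     Lp_strongly_measurable M p (variation_measure M p T n) r \<and>
     (\<forall>A\<in>bounded_borel T.
        has_Lp_integral M p (restrict_space (variation_measure M p T n) A) r (path_measure M p T n A))"


section \<open>Integrals\<close>

text \<open>\<open>\<integral>\<^bsub>[0,t]\<^esub> K(s) d\<nu>\<^sub>s\<close> for an operator-valued \<open>K\<close> and a path \<open>n\<close> with density \<open>r\<close>.\<close>

definition operator_path_integral ::
  "'d measure \<Rightarrow> real \<Rightarrow> ereal \<Rightarrow> (real \<Rightarrow> 'd \<Rightarrow> real) \<Rightarrow> (real \<Rightarrow> 'd \<Rightarrow> real) \<Rightarrow> real \<Rightarrow>
   (real \<Rightarrow> ('d \<Rightarrow> real) \<Rightarrow> ('d \<Rightarrow> real)) \<Rightarrow> 'd \<Rightarrow> real" where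
  "operator_path_integral M p T n r t K =
     Lp_integral M p (restrict_space (variation_measure M p T n) {0..t}) (\<lambda>s. K s (r s))"

text \<open>\<open>\<integral>\<^bsub>[0,T]\<^esub> \<langle>h\<^sub>s, d\<nu>\<^sub>s\<rangle>\<close> for a family \<open>h\<close> of \<open>[0,\<infinity>]\<close>-valued functions.\<close>

definition dual_path_integral ::
  "'d measure \<Rightarrow> real \<Rightarrow> ereal \<Rightarrow> (real \<Rightarrow> 'd \<Rightarrow> real) \<Rightarrow> (real \<Rightarrow> 'd \<Rightarrow> real) \<Rightarrow>
   (real \<Rightarrow> 'd \<Rightarrow> ennreal) \<Rightarrow> ennreal" where
  "dual_path_integral M p T n r h =
     (\<integral>\<^sup>+s. Lp_pairing_ext M (h s) (r s) \<partial>(variation_measure M p T n))"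

text \<open>
  \<open>h\<close> is the integral over \<open>A\<close>, pointwise in \<open>x\<close>, of the nonnegative \<open>L\<^sup>p\<close>-valued function \<open>g\<close>.
  As the values of \<open>g\<close> are only determined almost everywhere, the pointwise integral is that of
  a jointly measurable version \<open>\<phi>\<close> of \<open>g\<close>; any two versions give the same pairings of \<open>h\<close> with
  elements of the positive cone.
\<close>

definition pointwise_integral ::
  "'d measure \<Rightarrow> real measure \<Rightarrow> real set \<Rightarrow> (real \<Rightarrow> 'd \<Rightarrow> real) \<Rightarrow> ('d \<Rightarrow> ennreal) \<Rightarrow> bool" where
  "pointwise_integral M q A g h \<longleftrightarrow>
     (\<exists>\<phi> :: real \<times> 'd \<Rightarrow> ennreal.
        \<phi> \<in> borel_measurable (q \<Otimes>\<^sub>M M) \<and>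
        (AE t in q. t \<in> A \<longrightarrow> (AE x in M. \<phi> (t, x) = ennreal (g t x))) \<and>
        (\<forall>x\<in>space M. h x = (\<integral>\<^sup>+t\<in>A. \<phi> (t, x) \<partial>q)))"

end

theory Submission
  imports Defs
begin

text \<open>
  The identity is pathwise: it holds for every \<open>\<omega>\<close>, so let \<open>\<omega>\<close> be fixed and write \<open>V\<close> for the
  variation measure of the path and \<open>r\<close> for its density.  Both sides are iterated integrals of

    \<open>a(t,s) = \<langle>f\<^sub>t, \<Theta>(t,s) r\<^sub>s\<rangle> \<ge> 0\<close> for \<open>s \<le> t\<close>,

  on the left first in \<open>V(ds)\<close> over \<open>[0,t]\<close>, then in \<open>q(dt)\<close>, and on the right in the opposite order.
  Tonelli's theorem for \<open>q \<otimes> V\<close> exchanges them.  Three points need an argument.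

  The left inner integral.  A continuous functional commutes with the Bochner integral
  (\<open>Lp_pairing_has_Lp_integral\<close>), provided that \<open>s \<mapsto> \<Theta>(t,s) r\<^sub>s\<close> is Bochner integrable over \<open>[0,t]\<close>
  (\<open>operator_has_Lp_integral\<close>).  The operators \<open>\<Theta>(t,s)\<close>, \<open>s \<le> t\<close>, are bounded at every vector by
  strong continuity and compactness of \<open>[0,t]\<close>, hence uniformly bounded.  For positive operators this
  form of the Banach-Steinhaus theorem follows from the convergence of series of positive functions
  (\<open>Lp_positive_operators_uniformly_bounded\<close>).  Simple approximations of \<open>r\<close>, with \<open>s\<close> in \<open>\<Theta>(t,s)\<close>
  rounded down to a dyadic grid, then give simple approximations of \<open>\<Theta>(t,s) r\<^sub>s\<close>.

  The right inner integral.  It is the Tonelli theorem for \<open>q\<close> and the measure \<open>r\<^sub>s dM\<close>, which is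
  \<open>\<sigma>\<close>-finite even where \<open>M\<close> is not, followed by \<open>\<langle>\<Theta>\<^sup>*(t,s) f\<^sub>t, r\<^sub>s\<rangle> = \<langle>f\<^sub>t, \<Theta>(t,s) r\<^sub>s\<rangle>\<close>
  (\<open>Lp_pairing_ext_pointwise_integral\<close>).

  Joint measurability of \<open>a\<close>.  The function \<open>f\<close> need not be a limit of simple functions, since
  \<open>L\<^sup>p\<close> need not be separable.  But \<open>t \<mapsto> \<langle>f\<^sub>t, v\<rangle>\<close> is measurable for every fixed \<open>v\<close>, and
  \<open>\<Theta>(t,s) r\<^sub>s\<close> is, outside a null set of \<open>s\<close>, a limit of functions of \<open>(t,s)\<close> with countably many values
  (\<open>operator_density_pairing_jointly_measurable\<close>).
\<close>

section \<open>The seminormed space \<open>L\<^sup>p\<close>\<close>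

text \<open>Convexity of \<open>z \<mapsto> z\<^sup>p\<close> for the convex combination of \<open>\<bar>x\<bar>/a\<close> and \<open>\<bar>y\<bar>/b\<close> with the weights
  \<open>a/(a+b)\<close> and \<open>b/(a+b)\<close>.  The boundary point \<open>0\<close> of the half-line is treated separately.\<close>

lemma abs_add_powr_le_weighted:
  fixes x y a b p :: real
  assumes "1 \<le> p" "0 < a" "0 < b"
  shows "\<bar>x + y\<bar> powr p
    \<le> (a + b) powr (p - 1) * (a powr (1 - p) * \<bar>x\<bar> powr p + b powr (1 - p) * \<bar>y\<bar> powr p)"
proof -
  have key: "(X + Y) powr p \<le> (a + b) powr (p - 1) * (a powr (1 - p) * X powr p + b powr (1 - p) * Y powr p)"
    if X: "0 < X" and Y: "0 < Y" for X Y
  proof -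
    let ?w = "b / (a + b)"
    have w: "1 - ?w = a / (a + b)"
      using assms by (simp add: field_simps)
    have "((1 - ?w) *\<^sub>R (X / a) + ?w *\<^sub>R (Y / b)) powr p
        \<le> (1 - ?w) * (X / a) powr p + ?w * (Y / b) powr p"
      using assms X Y by (intro convex_onD[OF powr_convex]) auto
    moreover have "(1 - ?w) *\<^sub>R (X / a) + ?w *\<^sub>R (Y / b) = (X + Y) / (a + b)"
      unfolding w using assms by (simp add: add_divide_distrib)
    ultimately have "((X + Y) / (a + b)) powr p
        \<le> a / (a + b) * (X / a) powr p + b / (a + b) * (Y / b) powr p"
      unfolding w by simp
    then have "(a + b) powr p * ((X + Y) / (a + b)) powr p
        \<le> (a + b) powr p * (a / (a + b) * (X / a) powr p + b / (a + b) * (Y / b) powr p)"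
      by (intro mult_left_mono) auto
    moreover have "(a + b) powr p * ((X + Y) / (a + b)) powr p = (X + Y) powr p"
      using assms X Y by (simp add: powr_divide)
    moreover have "(a + b) powr p * (a / (a + b) * (X / a) powr p + b / (a + b) * (Y / b) powr p)
      = (a + b) powr (p - 1) * (a powr (1 - p) * X powr p + b powr (1 - p) * Y powr p)"
    proof -
      have "s powr p * (c / s * (Z / c) powr p) = s powr (p - 1) * (c powr (1 - p) * Z powr p)"
        if "0 < s" "0 < c" "0 < Z" for s c Z
        using that by (simp add: powr_divide powr_diff)
      from this[of "a + b" a X] this[of "a + b" b Y] show ?thesis
        using assms X Y by (simp only: distrib_left)
    qed
    ultimately show ?thesis by simp
  qed
  have one: "Y powr p \<le> (a' + b') powr (p - 1) * (b' powr (1 - p) * Y powr p)"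
    if "0 < a'" "0 < b'" for Y a' b' :: real
  proof -
    have "1 = b' powr (p - 1) * b' powr (1 - p)"
      using that by (simp add: powr_add[symmetric])
    also have "\<dots> \<le> (a' + b') powr (p - 1) * b' powr (1 - p)"
      using that assms by (intro mult_right_mono powr_mono2) auto
    finally show ?thesis
      using mult_right_mono[of 1 "(a' + b') powr (p - 1) * b' powr (1 - p)" "Y powr p"]
      by (simp add: mult.assoc)
  qed
  have "\<bar>x + y\<bar> powr p \<le> (\<bar>x\<bar> + \<bar>y\<bar>) powr p"
    using assms by (intro powr_mono2) auto
  also have "\<dots> \<le> (a + b) powr (p - 1) * (a powr (1 - p) * \<bar>x\<bar> powr p + b powr (1 - p) * \<bar>y\<bar> powr p)"
  proof (cases "x = 0 \<or> y = 0")
    case True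
    then show ?thesis
      using one[of a b "\<bar>y\<bar>"] one[of b a "\<bar>x\<bar>"] assms by (auto simp: add.commute)
  qed (use key[of "\<bar>x\<bar>" "\<bar>y\<bar>"] in auto)
  finally show ?thesis .
qed

lemma Lp_spaceD:
  assumes "v \<in> Lp_space M p"
  shows "v \<in> borel_measurable M" "integrable M (\<lambda>x. \<bar>v x\<bar> powr p)"
  using assms by (auto simp: Lp_space_def)

lemma Lp_norm_nonneg [simp]: "0 \<le> Lp_norm M p v"
  by (simp add: Lp_norm_def)

lemma Lp_dist_nonneg [simp]: "0 \<le> Lp_dist M p u v"
  by (simp add: Lp_dist_def)

lemma Lp_norm_powr:
  assumes "0 < p"
  shows "Lp_norm M p v powr p = (\<integral>x. \<bar>v x\<bar> powr p \<partial>M)"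
  using assms by (simp add: Lp_norm_def powr_powr)

lemma Lp_space_add:
  assumes "1 \<le> p" "u \<in> Lp_space M p" "v \<in> Lp_space M p"
  shows "(\<lambda>x. u x + v x) \<in> Lp_space M p"
proof -
  note [measurable] = Lp_spaceD(1)[OF assms(2)] Lp_spaceD(1)[OF assms(3)]
  have "integrable M (\<lambda>x. 2 powr (p - 1) * (\<bar>u x\<bar> powr p + \<bar>v x\<bar> powr p))"
    using assms by (auto dest: Lp_spaceD)
  then have "integrable M (\<lambda>x. \<bar>u x + v x\<bar> powr p)"
    by (rule Bochner_Integration.integrable_bound)
       (use abs_add_powr_le_weighted[OF assms(1), of 1 1] in auto)
  then show ?thesis
    by (simp add: Lp_space_def)
qed

lemma Lp_space_cmult:
  assumes "v \<in> Lp_space M p"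
  shows "(\<lambda>x. c * v x) \<in> Lp_space M p"
  using assms by (auto simp: Lp_space_def abs_mult powr_mult)

lemma Lp_space_minus: "v \<in> Lp_space M p \<Longrightarrow> (\<lambda>x. - v x) \<in> Lp_space M p"
  using Lp_space_cmult[of v M p "-1"] by simp

lemma Lp_space_zero: "(\<lambda>x. 0) \<in> Lp_space M p"
  by (simp add: Lp_space_def)

lemma Lp_space_abs: "v \<in> Lp_space M p \<Longrightarrow> (\<lambda>x. \<bar>v x\<bar>) \<in> Lp_space M p"
  by (auto simp: Lp_space_def)

lemma Lp_space_diff:
  assumes "1 \<le> p" "u \<in> Lp_space M p" "v \<in> Lp_space M p"
  shows "(\<lambda>x. u x - v x) \<in> Lp_space M p"
  using Lp_space_add[OF assms(1,2) Lp_space_minus[OF assms(3)]] by simp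

lemma Lp_space_sum:
  assumes "1 \<le> p" "\<And>i. i \<in> I \<Longrightarrow> u i \<in> Lp_space M p"
  shows "(\<lambda>x. \<Sum>i\<in>I. u i x) \<in> Lp_space M p"
  using assms(2)
  by (induction I rule: infinite_finite_induct) (auto intro: Lp_space_zero Lp_space_add assms(1))

lemma Lp_norm_le_iff:
  assumes "0 < p" "0 \<le> c"
  shows "Lp_norm M p v \<le> c \<longleftrightarrow> (\<integral>x. \<bar>v x\<bar> powr p \<partial>M) \<le> c powr p"
  using assms powr_mono_both'[of p p] unfolding Lp_norm_powr[OF assms(1), symmetric]
  by (metis Lp_norm_nonneg linorder_not_less powr_less_mono2 powr_mono2 less_eq_real_def)

lemma Lp_norm_mono:
  assumes "0 < p" "v \<in> Lp_space M p" "u \<in> borel_measurable M" "AE x in M. \<bar>u x\<bar> \<le> \<bar>v x\<bar>"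
  shows "u \<in> Lp_space M p" "Lp_norm M p u \<le> Lp_norm M p v"
proof -
  have le: "AE x in M. \<bar>u x\<bar> powr p \<le> \<bar>v x\<bar> powr p"
    using assms(4) by eventually_elim (use assms(1) in \<open>auto intro: powr_mono2\<close>)
  have i: "integrable M (\<lambda>x. \<bar>u x\<bar> powr p)"
    by (rule Bochner_Integration.integrable_bound[OF Lp_spaceD(2)[OF assms(2)]]) (use le assms(3) in auto)
  then show "u \<in> Lp_space M p"
    using assms(3) by (simp add: Lp_space_def)
  show "Lp_norm M p u \<le> Lp_norm M p v"
    using integral_mono_AE[OF i Lp_spaceD(2)[OF assms(2)] le] assms(1)
    by (simp add: Lp_norm_le_iff Lp_norm_powr)
qed

lemma Lp_norm_cong_AE:
  assumes "u \<in> borel_measurable M" "v \<in> borel_measurable M" "AE x in M. \<bar>u x\<bar> = \<bar>v x\<bar>"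
  shows "Lp_norm M p u = Lp_norm M p v"
proof -
  have "(\<integral>x. \<bar>u x\<bar> powr p \<partial>M) = (\<integral>x. \<bar>v x\<bar> powr p \<partial>M)"
    by (rule integral_cong_AE) (use assms in auto)
  then show ?thesis
    by (simp add: Lp_norm_def)
qed

lemma Lp_norm_cmult:
  assumes "0 < p"
  shows "Lp_norm M p (\<lambda>x. c * v x) = \<bar>c\<bar> * Lp_norm M p v"
  using assms by (simp add: Lp_norm_def abs_mult powr_mult powr_powr)

lemma Lp_norm_zero [simp]: "Lp_norm M p (\<lambda>x. 0) = 0"
  by (simp add: Lp_norm_def)

text \<open>Minkowski's inequality is the convexity of \<open>z \<mapsto> z\<^sup>p\<close> with the norms as weights; weights
  slightly larger than the norms avoid a separate treatment of null functions.\<close>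

lemma Lp_norm_triangle:
  assumes p: "1 \<le> p" and u: "u \<in> Lp_space M p" and v: "v \<in> Lp_space M p"
  shows "Lp_norm M p (\<lambda>x. u x + v x) \<le> Lp_norm M p u + Lp_norm M p v"
proof (rule field_le_epsilon)
  fix e :: real assume e: "0 < e"
  define a where "a = Lp_norm M p u + e / 2"
  define b where "b = Lp_norm M p v + e / 2"
  have a: "0 < a" "Lp_norm M p u \<le> a" and b: "0 < b" "Lp_norm M p v \<le> b"
    using e by (auto simp: a_def b_def intro: add_nonneg_pos)
  note iu = Lp_spaceD(2)[OF u] and iv = Lp_spaceD(2)[OF v]
  have "(\<integral>x. \<bar>u x + v x\<bar> powr p \<partial>M)
      \<le> (\<integral>x. (a + b) powr (p - 1) * (a powr (1 - p) * \<bar>u x\<bar> powr p + b powr (1 - p) * \<bar>v x\<bar> powr p) \<partial>M)"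
    using iu iv Lp_spaceD(2)[OF Lp_space_add[OF p u v]] abs_add_powr_le_weighted[OF p a(1) b(1)]
    by (intro integral_mono) auto
  also have "\<dots> = (a + b) powr (p - 1) * (a powr (1 - p) * Lp_norm M p u powr p + b powr (1 - p) * Lp_norm M p v powr p)"
    using iu iv p by (simp add: Lp_norm_powr)
  also have "\<dots> \<le> (a + b) powr (p - 1) * (a powr (1 - p) * a powr p + b powr (1 - p) * b powr p)"
    using a b p by (intro mult_left_mono add_mono powr_mono2) auto
  also have "\<dots> = (a + b) powr (p - 1) * (a + b)"
    using a b by (simp add: powr_add[symmetric])
  also have "\<dots> = (a + b) powr p"
    using a b by (simp add: powr_diff)
  finally have "Lp_norm M p (\<lambda>x. u x + v x) \<le> a + b"
    using a b p by (subst Lp_norm_le_iff) auto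
  then show "Lp_norm M p (\<lambda>x. u x + v x) \<le> Lp_norm M p u + Lp_norm M p v + e"
    by (simp add: a_def b_def)
qed

lemma Lp_norm_sum:
  assumes "1 \<le> p" "\<And>i. i \<in> I \<Longrightarrow> u i \<in> Lp_space M p"
  shows "Lp_norm M p (\<lambda>x. \<Sum>i\<in>I. u i x) \<le> (\<Sum>i\<in>I. Lp_norm M p (u i))"
  using assms(2)
proof (induction I rule: infinite_finite_induct)
  case (insert i I)
  have "Lp_norm M p (\<lambda>x. \<Sum>i\<in>insert i I. u i x) = Lp_norm M p (\<lambda>x. u i x + (\<Sum>i\<in>I. u i x))"
    using insert by simp
  also have "\<dots> \<le> Lp_norm M p (u i) + Lp_norm M p (\<lambda>x. \<Sum>i\<in>I. u i x)"
    using insert by (intro Lp_norm_triangle Lp_space_sum assms(1)) auto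
  finally show ?case
    using insert by simp
qed auto

lemma Lp_dist_commute: "Lp_dist M p u v = Lp_dist M p v u"
  by (simp add: Lp_dist_def Lp_norm_def abs_minus_commute)

lemma Lp_dist_self [simp]: "Lp_dist M p u u = 0"
  by (simp add: Lp_dist_def)

lemma Lp_dist_triangle:
  assumes "1 \<le> p" "u \<in> Lp_space M p" "v \<in> Lp_space M p" "w \<in> Lp_space M p"
  shows "Lp_dist M p u w \<le> Lp_dist M p u v + Lp_dist M p v w"
  using Lp_norm_triangle[OF assms(1) Lp_space_diff[OF assms(1,2,3)] Lp_space_diff[OF assms(1,3,4)]]
  by (simp add: Lp_dist_def)

lemma Lp_norm_le_dist:
  assumes "1 \<le> p" "u \<in> Lp_space M p" "v \<in> Lp_space M p"
  shows "Lp_norm M p u \<le> Lp_norm M p v + Lp_dist M p u v"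
  using Lp_norm_triangle[OF assms(1,3) Lp_space_diff[OF assms(1,2,3)]] by (simp add: Lp_dist_def)

section \<open>Hoelder's inequality and the pairing\<close>

lemma conj_exp:
  assumes "1 < p"
  shows "1 < conj_exp p" "1 / p + 1 / conj_exp p = 1" "(conj_exp p - 1) * p = conj_exp p"
  using assms by (auto simp: conj_exp_def field_simps)

text \<open>Young's inequality for \<open>g\<close> and \<open>v\<close> divided by numbers slightly larger than their norms, so that
  null functions cause no division by zero.\<close>

lemma Lp_holder:
  assumes p: "1 < p" and g: "g \<in> Lp_space M (conj_exp p)" and v: "v \<in> Lp_space M p"
  shows "integrable M (\<lambda>x. g x * v x)" "\<bar>Lp_pairing M g v\<bar> \<le> Lp_norm M (conj_exp p) g * Lp_norm M p v"
proof -
  let ?q = "conj_exp p"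
  have q: "1 < ?q" "1 / p + 1 / ?q = 1"
    using conj_exp[OF p] by auto
  note [measurable] = Lp_spaceD(1)[OF g] Lp_spaceD(1)[OF v]
  note ig = Lp_spaceD(2)[OF g] and iv = Lp_spaceD(2)[OF v]
  have young: "\<bar>g x * v x\<bar> \<le> \<bar>v x\<bar> powr p / p + \<bar>g x\<bar> powr ?q / ?q" for x
    using Youngs_inequality[of p ?q "\<bar>v x\<bar>" "\<bar>g x\<bar>"] p q by (simp add: abs_mult mult.commute)
  have "integrable M (\<lambda>x. \<bar>v x\<bar> powr p / p + \<bar>g x\<bar> powr ?q / ?q)"
    using ig iv by auto
  then show i: "integrable M (\<lambda>x. g x * v x)"
    by (rule Bochner_Integration.integrable_bound) (auto intro!: order_trans[OF young abs_ge_self])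
  have le: "(\<integral>x. \<bar>g x * v x\<bar> \<partial>M) \<le> (Lp_norm M ?q g + e) * (Lp_norm M p v + e)" if e: "0 < e" for e
  proof -
    define a where "a = Lp_norm M ?q g + e"
    define b where "b = Lp_norm M p v + e"
    have a: "0 < a" "Lp_norm M ?q g \<le> a" and b: "0 < b" "Lp_norm M p v \<le> b"
      using e by (auto simp: a_def b_def intro: add_nonneg_pos)
    have y: "\<bar>g x * v x\<bar> \<le> a * b * (b powr (-p) * \<bar>v x\<bar> powr p / p + a powr (-?q) * \<bar>g x\<bar> powr ?q / ?q)" for x
    proof -
      have "\<bar>v x\<bar> / b * (\<bar>g x\<bar> / a) \<le> (\<bar>v x\<bar> / b) powr p / p + (\<bar>g x\<bar> / a) powr ?q / ?q"
        using Youngs_inequality[of p ?q "\<bar>v x\<bar> / b" "\<bar>g x\<bar> / a"] p q a b by simp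
      then have "a * b * (\<bar>v x\<bar> / b * (\<bar>g x\<bar> / a)) \<le> a * b * ((\<bar>v x\<bar> / b) powr p / p + (\<bar>g x\<bar> / a) powr ?q / ?q)"
        using a b by (intro mult_left_mono) auto
      then show ?thesis
        using a b by (simp add: powr_divide powr_minus_divide abs_mult mult.commute)
    qed
    have "(\<integral>x. \<bar>g x * v x\<bar> \<partial>M)
        \<le> (\<integral>x. a * b * (b powr (-p) * \<bar>v x\<bar> powr p / p + a powr (-?q) * \<bar>g x\<bar> powr ?q / ?q) \<partial>M)"
      using ig iv i y by (intro integral_mono) auto
    also have "\<dots> = a * b * (b powr (-p) * Lp_norm M p v powr p / p + a powr (-?q) * Lp_norm M ?q g powr ?q / ?q)"
      using ig iv p q(1) by (simp add: Lp_norm_powr)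
    also have "\<dots> \<le> a * b * (b powr (-p) * b powr p / p + a powr (-?q) * a powr ?q / ?q)"
      using a b p q(1) by (intro mult_left_mono add_mono divide_right_mono powr_mono2) auto
    also have "\<dots> = a * b"
      using a b q(2) by (simp add: powr_add[symmetric])
    finally show ?thesis
      by (simp add: a_def b_def)
  qed
  have "\<bar>Lp_pairing M g v\<bar> \<le> (\<integral>x. \<bar>g x * v x\<bar> \<partial>M)"
    unfolding Lp_pairing_def by (rule integral_abs_bound)
  also have "\<dots> \<le> Lp_norm M ?q g * Lp_norm M p v"
  proof (rule tendsto_lowerbound)
    show "((\<lambda>e. (Lp_norm M ?q g + e) * (Lp_norm M p v + e)) \<longlongrightarrow> Lp_norm M ?q g * Lp_norm M p v) (at_right 0)"
      by (auto intro!: tendsto_eq_intros)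
    show "\<forall>\<^sub>F e in at_right 0. (\<integral>x. \<bar>g x * v x\<bar> \<partial>M) \<le> (Lp_norm M ?q g + e) * (Lp_norm M p v + e)"
      using le by (auto simp: eventually_at_filter)
  qed auto
  finally show "\<bar>Lp_pairing M g v\<bar> \<le> Lp_norm M ?q g * Lp_norm M p v" .
qed

lemma Lp_pairing_diff_right:
  assumes "1 < p" "g \<in> Lp_space M (conj_exp p)" "u \<in> Lp_space M p" "v \<in> Lp_space M p"
  shows "Lp_pairing M g (\<lambda>x. u x - v x) = Lp_pairing M g u - Lp_pairing M g v"
  using Lp_holder(1)[OF assms(1,2,3)] Lp_holder(1)[OF assms(1,2,4)]
  by (simp add: Lp_pairing_def algebra_simps)

lemma Lp_pairing_diff_left:
  assumes "1 < p" "g \<in> Lp_space M (conj_exp p)" "h \<in> Lp_space M (conj_exp p)" "v \<in> Lp_space M p"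
  shows "Lp_pairing M (\<lambda>x. g x - h x) v = Lp_pairing M g v - Lp_pairing M h v"
  using Lp_holder(1)[OF assms(1,2,4)] Lp_holder(1)[OF assms(1,3,4)]
  by (simp add: Lp_pairing_def algebra_simps)

lemma Lp_pairing_dist:
  assumes "1 < p" "g \<in> Lp_space M (conj_exp p)" "u \<in> Lp_space M p" "v \<in> Lp_space M p"
  shows "\<bar>Lp_pairing M g u - Lp_pairing M g v\<bar> \<le> Lp_norm M (conj_exp p) g * Lp_dist M p u v"
  using Lp_holder(2)[OF assms(1,2) Lp_space_diff[OF _ assms(3,4)]] assms(1)
  by (simp add: Lp_pairing_diff_right[OF assms] Lp_dist_def)

lemma tendsto_Lp_pairing:
  assumes "1 < p" "g \<in> Lp_space M (conj_exp p)" "\<And>i. u i \<in> Lp_space M p" "v \<in> Lp_space M p"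
    and "(\<lambda>i. Lp_dist M p (u i) v) \<longlonglongrightarrow> 0"
  shows "(\<lambda>i. Lp_pairing M g (u i)) \<longlonglongrightarrow> Lp_pairing M g v"
proof -
  have "(\<lambda>i. Lp_norm M (conj_exp p) g * Lp_dist M p (u i) v) \<longlonglongrightarrow> 0"
    using tendsto_mult_left[OF assms(5), of "Lp_norm M (conj_exp p) g"] by simp
  then have "(\<lambda>i. Lp_pairing M g (u i) - Lp_pairing M g v) \<longlonglongrightarrow> 0"
    by (rule Lim_null_comparison[rotated]) (use Lp_pairing_dist[OF assms(1-3,4)] in auto)
  then show ?thesis
    by (simp add: LIM_zero_iff)
qed

lemma Lp_pairing_nonneg:
  assumes "g \<in> Lp_cone M q" "v \<in> Lp_cone M p"
  shows "0 \<le> Lp_pairing M g v"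
  unfolding Lp_pairing_def
  by (rule integral_nonneg_AE) (use assms in \<open>auto simp: Lp_cone_def\<close>)

text \<open>The function \<open>(-g)\<^sub>+\<^bsup>q-1\<^esup>\<close>, with \<open>q\<close> the exponent of \<open>g\<close>, lies in the dual cone and
  pairs with \<open>g\<close> to minus the \<open>q\<close>-th power of the norm of the negative part.\<close>

lemma Lp_cone_if_pairing_nonneg:
  assumes p: "1 < p" and g: "g \<in> Lp_space M (conj_exp p)"
    and pos: "\<And>v. v \<in> Lp_cone M p \<Longrightarrow> 0 \<le> Lp_pairing M g v"
  shows "g \<in> Lp_cone M (conj_exp p)"
proof -
  let ?q = "conj_exp p"
  have q: "1 < ?q" "(?q - 1) * p = ?q"
    using conj_exp[OF p] by auto
  note [measurable] = Lp_spaceD(1)[OF g]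
  define m where "m x = max 0 (- g x)" for x
  have [measurable]: "m \<in> borel_measurable M"
    unfolding m_def by simp
  have m: "m \<in> Lp_space M ?q"
    by (rule Lp_norm_mono(1)[OF _ g]) (use q in \<open>auto simp: m_def\<close>)
  note im = Lp_spaceD(2)[OF m]
  have "(\<lambda>x. m x powr (?q - 1)) \<in> Lp_cone M p"
    using im by (auto simp: Lp_cone_def Lp_space_def powr_powr q(2) m_def)
  from pos[OF this] have "0 \<le> (\<integral>x. g x * m x powr (?q - 1) \<partial>M)"
    by (simp add: Lp_pairing_def)
  also have "(\<lambda>x. g x * m x powr (?q - 1)) = (\<lambda>x. - (\<bar>m x\<bar> powr ?q))"
  proof
    fix x
    show "g x * m x powr (?q - 1) = - (\<bar>m x\<bar> powr ?q)"
      using q(1) by (auto simp: m_def max_def powr_diff)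
  qed
  finally have "(\<integral>x. \<bar>m x\<bar> powr ?q \<partial>M) = 0"
    by (simp add: order.antisym)
  then have "AE x in M. \<bar>m x\<bar> powr ?q = 0"
    by (subst (asm) integral_nonneg_eq_0_iff_AE[OF im]) auto
  then have "AE x in M. 0 \<le> g x"
    by eventually_elim (auto simp: m_def max_def split: if_splits)
  with g show ?thesis
    by (simp add: Lp_cone_def)
qed

section \<open>Completeness\<close>

lemma nn_integral_powr_eq_Lp_norm:
  assumes "0 < p" "v \<in> Lp_space M p"
  shows "(\<integral>\<^sup>+x. ennreal (\<bar>v x\<bar> powr p) \<partial>M) = ennreal (Lp_norm M p v powr p)"
  using nn_integral_eq_integral[OF Lp_spaceD(2)[OF assms(2)]] by (simp add: Lp_norm_powr[OF assms(1)])

lemma Lp_normI_nn_integral: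
  assumes "0 < p" "0 \<le> B" and [measurable]: "v \<in> borel_measurable M"
    and le: "(\<integral>\<^sup>+x. ennreal (\<bar>v x\<bar> powr p) \<partial>M) \<le> ennreal (B powr p)"
  shows "v \<in> Lp_space M p" "Lp_norm M p v \<le> B"
proof -
  have "integrable M (\<lambda>x. \<bar>v x\<bar> powr p)"
    by (rule integrableI_nonneg) (use le in \<open>auto simp: le_less_trans\<close>)
  then show v: "v \<in> Lp_space M p"
    by (simp add: Lp_space_def)
  show "Lp_norm M p v \<le> B"
    using le unfolding nn_integral_powr_eq_Lp_norm[OF assms(1) v] Lp_norm_le_iff[OF assms(1,2)]
    by (simp add: Lp_norm_powr[OF assms(1)])
qed

text \<open>Fatou's lemma for the \<open>p\<close>-th powers: norm balls are closed under almost everywhere limits.\<close>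

lemma Lp_fatou:
  assumes p: "0 < p" and u: "\<And>n::nat. u n \<in> Lp_space M p" and B: "0 \<le> B" "\<And>n. Lp_norm M p (u n) \<le> B"
    and [measurable]: "v \<in> borel_measurable M" and lim: "AE x in M. (\<lambda>n. u n x) \<longlonglongrightarrow> v x"
  shows "v \<in> Lp_space M p" "Lp_norm M p v \<le> B"
proof -
  note [measurable] = Lp_spaceD(1)[OF u]
  have "(\<integral>\<^sup>+x. ennreal (\<bar>v x\<bar> powr p) \<partial>M) = (\<integral>\<^sup>+x. liminf (\<lambda>n. ennreal (\<bar>u n x\<bar> powr p)) \<partial>M)"
  proof (rule nn_integral_cong_AE)
    show "AE x in M. ennreal (\<bar>v x\<bar> powr p) = liminf (\<lambda>n. ennreal (\<bar>u n x\<bar> powr p))"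
      using lim
    proof eventually_elim
      case (elim x)
      have "(\<lambda>n. \<bar>u n x\<bar> powr p) \<longlonglongrightarrow> \<bar>v x\<bar> powr p"
        using elim p by (intro tendsto_powr2 tendsto_rabs) auto
      then have "(\<lambda>n. ennreal (\<bar>u n x\<bar> powr p)) \<longlonglongrightarrow> ennreal (\<bar>v x\<bar> powr p)"
        by (rule tendsto_ennrealI)
      then show ?case
        by (intro lim_imp_Liminf[symmetric]) auto
    qed
  qed
  also have "\<dots> \<le> liminf (\<lambda>n. \<integral>\<^sup>+x. ennreal (\<bar>u n x\<bar> powr p) \<partial>M)"
    by (rule nn_integral_liminf) simp
  also have "\<dots> \<le> ennreal (B powr p)"
  proof (rule Liminf_le)
    show "\<forall>\<^sub>F n in sequentially. (\<integral>\<^sup>+x. ennreal (\<bar>u n x\<bar> powr p) \<partial>M) \<le> ennreal (B powr p)"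
      using B p by (auto simp: nn_integral_powr_eq_Lp_norm[OF p u] intro!: always_eventually ennreal_leI powr_mono2)
  qed simp
  finally have "(\<integral>\<^sup>+x. ennreal (\<bar>v x\<bar> powr p) \<partial>M) \<le> ennreal (B powr p)" .
  from Lp_normI_nn_integral[OF p B(1) _ this] show "v \<in> Lp_space M p" "Lp_norm M p v \<le> B"
    by auto
qed

text \<open>By Minkowski's inequality the increasing partial sums of \<open>\<bar>d\<^sub>k\<bar>\<close> stay in a norm ball, so by
  monotone convergence the \<open>p\<close>-th power of their supremum has a finite integral.\<close>

lemma Lp_series_AE_summable:
  assumes p: "1 \<le> p" and d: "\<And>k. d k \<in> Lp_space M p" and s: "summable (\<lambda>k. Lp_norm M p (d k))"
  shows "AE x in M. summable (\<lambda>k. \<bar>d k x\<bar>)"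
proof -
  define B where "B = (\<Sum>k. Lp_norm M p (d k))"
  define w where "w n x = (\<Sum>k<n. \<bar>d k x\<bar>)" for n x
  have B: "0 \<le> B"
    unfolding B_def by (intro suminf_nonneg s) simp
  note [measurable] = Lp_spaceD(1)[OF d]
  have [measurable]: "w n \<in> borel_measurable M" for n
    unfolding w_def by simp
  have w: "w n \<in> Lp_space M p" for n
    unfolding w_def by (intro Lp_space_sum p Lp_space_abs d)
  have "Lp_norm M p (w n) \<le> (\<Sum>k<n. Lp_norm M p (\<lambda>x. \<bar>d k x\<bar>))" for n
    unfolding w_def by (intro Lp_norm_sum p Lp_space_abs d)
  also have "(\<Sum>k<n. Lp_norm M p (\<lambda>x. \<bar>d k x\<bar>)) \<le> B" for n
    unfolding B_def using sum_le_suminf[OF s, of "{..<n}"] by (simp add: Lp_norm_def)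
  finally have wB: "Lp_norm M p (w n) \<le> B" for n .
  have "(\<integral>\<^sup>+x. (SUP n. ennreal (\<bar>w n x\<bar> powr p)) \<partial>M) = (SUP n. \<integral>\<^sup>+x. ennreal (\<bar>w n x\<bar> powr p) \<partial>M)"
  proof (rule nn_integral_monotone_convergence_SUP)
    show "incseq (\<lambda>n x. ennreal (\<bar>w n x\<bar> powr p))"
      using p by (intro incseq_SucI le_funI ennreal_leI powr_mono2) (auto simp: w_def sum_nonneg)
  qed simp
  also have "\<dots> \<le> ennreal (B powr p)"
    using p wB by (intro SUP_least) (auto simp: nn_integral_powr_eq_Lp_norm[OF _ w] intro!: powr_mono2)
  finally have "AE x in M. (SUP n. ennreal (\<bar>w n x\<bar> powr p)) \<noteq> \<infinity>"
    by (intro nn_integral_noteq_infinite) (auto simp: top_unique)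
  then show ?thesis
  proof eventually_elim
    case (elim x)
    then obtain c where c: "0 \<le> c" "(SUP n. ennreal (\<bar>w n x\<bar> powr p)) = ennreal c"
      unfolding infinity_ennreal_def by (metis ennreal_cases)
    have wc: "w n x \<le> c powr (1 / p)" for n
    proof -
      have "ennreal (\<bar>w n x\<bar> powr p) \<le> ennreal c"
        unfolding c(2)[symmetric] by (rule SUP_upper) simp
      then have "\<bar>w n x\<bar> powr p \<le> c"
        using c(1) by simp
      then have "(\<bar>w n x\<bar> powr p) powr (1 / p) \<le> c powr (1 / p)"
        using p by (intro powr_mono2) auto
      then show ?thesis
        using p by (simp add: powr_powr)
    qed
    show ?case
      by (rule summableI_nonneg_bounded[where x="c powr (1 / p)"]) (use wc in \<open>auto simp: w_def\<close>)
  qed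
qed

text \<open>The Riesz-Fischer theorem for absolutely convergent series.  Each tail is an almost everywhere
  limit of finite sums, so \<open>Lp_fatou\<close> bounds its norm by the tail of the series of norms.\<close>

lemma Lp_series:
  assumes p: "1 \<le> p" and d: "\<And>k. d k \<in> Lp_space M p" and s: "summable (\<lambda>k. Lp_norm M p (d k))"
  obtains v where "v \<in> Lp_space M p" "AE x in M. (\<lambda>k. d k x) sums v x"
    "(\<lambda>n. Lp_dist M p (\<lambda>x. \<Sum>k<n. d k x) v) \<longlonglongrightarrow> 0"
proof -
  define v where "v x = (\<Sum>k. d k x)" for x
  note [measurable] = Lp_spaceD(1)[OF d]
  have [measurable]: "v \<in> borel_measurable M"
    unfolding v_def by simp
  have sums: "AE x in M. (\<lambda>k. d k x) sums v x"
    using Lp_series_AE_summable[OF assms]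
    by eventually_elim (auto simp: v_def intro: summable_sums summable_rabs_cancel)
  have tail: "(\<lambda>x. v x - (\<Sum>k<n. d k x)) \<in> Lp_space M p
      \<and> Lp_norm M p (\<lambda>x. v x - (\<Sum>k<n. d k x)) \<le> (\<Sum>k. Lp_norm M p (d (k + n)))" for n
  proof -
    have sn: "summable (\<lambda>k. Lp_norm M p (d (k + n)))"
      using s by (subst summable_iff_shift)
    have le: "Lp_norm M p (\<lambda>x. \<Sum>k<m. d (k + n) x) \<le> (\<Sum>k. Lp_norm M p (d (k + n)))" for m
    proof -
      have "Lp_norm M p (\<lambda>x. \<Sum>k<m. d (k + n) x) \<le> (\<Sum>k<m. Lp_norm M p (d (k + n)))"
        by (intro Lp_norm_sum p d)
      also have "\<dots> \<le> (\<Sum>k. Lp_norm M p (d (k + n)))"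
        by (intro sum_le_suminf sn) auto
      finally show ?thesis .
    qed
    have lim: "AE x in M. (\<lambda>m. \<Sum>k<m. d (k + n) x) \<longlonglongrightarrow> v x - (\<Sum>k<n. d k x)"
      using sums by eventually_elim (drule sums_split_initial_segment[where n=n], simp add: sums_def)
    have sp: "(\<lambda>x. \<Sum>k<m. d (k + n) x) \<in> Lp_space M p" for m
      by (intro Lp_space_sum p d)
    have ge: "0 \<le> (\<Sum>k. Lp_norm M p (d (k + n)))"
      by (intro suminf_nonneg sn) simp
    have "0 < p"
      using p by simp
    moreover have "(\<lambda>x. v x - (\<Sum>k<n. d k x)) \<in> borel_measurable M"
      by simp
    ultimately show ?thesis
      using Lp_fatou[OF _ sp ge le _ lim] by blast
  qed
  have "(\<lambda>n. \<Sum>k. Lp_norm M p (d (k + n))) \<longlonglongrightarrow> 0"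
    using suminf_exist_split2[OF s] .
  then have "(\<lambda>n. Lp_dist M p v (\<lambda>x. \<Sum>k<n. d k x)) \<longlonglongrightarrow> 0"
    by (rule Lim_null_comparison[rotated]) (use tail in \<open>auto simp: Lp_dist_def\<close>)
  moreover have "v \<in> Lp_space M p"
    using tail[of 0] by simp
  ultimately show thesis
    using sums that by (auto simp: Lp_dist_commute)
qed

lemma Lp_limit_of_fast_Cauchy:
  assumes p: "1 \<le> p" and u: "\<And>k. u k \<in> Lp_space M p" and s: "summable (\<lambda>k. Lp_dist M p (u (Suc k)) (u k))"
  obtains v where "v \<in> Lp_space M p" "(\<lambda>n. Lp_dist M p (u n) v) \<longlonglongrightarrow> 0"
proof -
  let ?d = "\<lambda>k x. u (Suc k) x - u k x"
  obtain w where w: "w \<in> Lp_space M p" "(\<lambda>n. Lp_dist M p (\<lambda>x. \<Sum>k<n. ?d k x) w) \<longlonglongrightarrow> 0"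
    by (rule Lp_series[OF p, of ?d M])
       (use s that in \<open>auto simp: Lp_dist_def intro: Lp_space_diff p u\<close>)
  have "(\<lambda>x. w x + u 0 x) \<in> Lp_space M p"
    by (intro Lp_space_add p w u)
  moreover have "(\<lambda>n. Lp_dist M p (u n) (\<lambda>x. w x + u 0 x)) \<longlonglongrightarrow> 0"
    using w(2) unfolding sum_lessThan_telescope[of "\<lambda>k. u k x" for x] Lp_dist_def
    by (simp add: diff_diff_eq add.commute)
  ultimately show thesis
    by (rule that)
qed

section \<open>Positive operators\<close>

lemma Lp_positive_operatorD:
  assumes "Lp_positive_operator M p K"
  shows "v \<in> Lp_space M p \<Longrightarrow> K v \<in> Lp_space M p"
    and "u \<in> Lp_space M p \<Longrightarrow> v \<in> Lp_space M p \<Longrightarrow> AE x in M. K (\<lambda>y. a * u y + b * v y) x = a * K u x + b * K v x"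
    and "\<exists>C. \<forall>v\<in>Lp_space M p. Lp_norm M p (K v) \<le> C * Lp_norm M p v"
    and "v \<in> Lp_cone M p \<Longrightarrow> K v \<in> Lp_cone M p"
  using assms by (auto simp: Lp_positive_operator_def)

lemma Lp_positive_operator_dist:
  assumes p: "1 \<le> p" and K: "Lp_positive_operator M p K" and u: "u \<in> Lp_space M p" and v: "v \<in> Lp_space M p"
  shows "Lp_dist M p (K u) (K v) = Lp_norm M p (K (\<lambda>x. u x - v x))"
proof -
  note [measurable] = Lp_spaceD(1)[OF Lp_positive_operatorD(1)[OF K u]]
    Lp_spaceD(1)[OF Lp_positive_operatorD(1)[OF K v]]
    Lp_spaceD(1)[OF Lp_positive_operatorD(1)[OF K Lp_space_diff[OF p u v]]]
  have "AE x in M. K (\<lambda>x. u x - v x) x = K u x - K v x"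
    using Lp_positive_operatorD(2)[OF K u v, of 1 "-1"] by simp
  then show ?thesis
    unfolding Lp_dist_def by (intro Lp_norm_cong_AE) auto
qed

text \<open>Positivity of \<open>K\<close> on \<open>\<bar>v\<bar> + v\<close> and on \<open>\<bar>v\<bar> - v\<close>.\<close>

lemma Lp_positive_operator_abs:
  assumes p: "1 \<le> p" and K: "Lp_positive_operator M p K" and v: "v \<in> Lp_space M p"
  shows "AE x in M. \<bar>K v x\<bar> \<le> K (\<lambda>x. \<bar>v x\<bar>) x"
proof -
  note a = Lp_space_abs[OF v]
  have "(\<lambda>x. 1 * \<bar>v x\<bar> + 1 * v x) \<in> Lp_cone M p" "(\<lambda>x. 1 * \<bar>v x\<bar> + (-1) * v x) \<in> Lp_cone M p"
    using Lp_space_add[OF p a v] Lp_space_diff[OF p a v] by (auto simp: Lp_cone_def)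
  from Lp_positive_operatorD(4)[OF K this(1)] Lp_positive_operatorD(4)[OF K this(2)]
  have "AE x in M. 0 \<le> K (\<lambda>x. 1 * \<bar>v x\<bar> + 1 * v x) x" "AE x in M. 0 \<le> K (\<lambda>x. 1 * \<bar>v x\<bar> + (-1) * v x) x"
    by (auto simp: Lp_cone_def)
  then show ?thesis
    using Lp_positive_operatorD(2)[OF K a v, of 1 1] Lp_positive_operatorD(2)[OF K a v, of 1 "-1"]
    by eventually_elim auto
qed

lemma Lp_positive_operator_mono:
  assumes p: "1 \<le> p" and K: "Lp_positive_operator M p K"
    and u: "u \<in> Lp_space M p" and v: "v \<in> Lp_space M p" and le: "AE x in M. \<bar>u x\<bar> \<le> v x"
  shows "Lp_norm M p (K u) \<le> Lp_norm M p (K v)"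
proof -
  note a = Lp_space_abs[OF u]
  have "(\<lambda>x. 1 * v x + (-1) * \<bar>u x\<bar>) \<in> Lp_cone M p"
    using Lp_space_diff[OF p v a] le by (auto simp: Lp_cone_def)
  from Lp_positive_operatorD(4)[OF K this] have "AE x in M. 0 \<le> K (\<lambda>x. 1 * v x + (-1) * \<bar>u x\<bar>) x"
    by (auto simp: Lp_cone_def)
  then have "AE x in M. \<bar>K u x\<bar> \<le> \<bar>K v x\<bar>"
    using Lp_positive_operatorD(2)[OF K v a, of 1 "-1"] Lp_positive_operator_abs[OF p K u]
    by eventually_elim auto
  then show ?thesis
    using p Lp_spaceD(1) Lp_positive_operatorD(1)[OF K] u v by (intro Lp_norm_mono(2)) auto
qed

lemma Lp_positive_operator_cmult:
  assumes p: "1 \<le> p" and K: "Lp_positive_operator M p K" and v: "v \<in> Lp_space M p"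
  shows "Lp_norm M p (K (\<lambda>x. c * v x)) = \<bar>c\<bar> * Lp_norm M p (K v)"
proof -
  note [measurable] = Lp_spaceD(1)[OF Lp_positive_operatorD(1)[OF K v]]
    Lp_spaceD(1)[OF Lp_positive_operatorD(1)[OF K Lp_space_cmult[OF v]]]
  have "AE x in M. K (\<lambda>x. c * v x) x = c * K v x"
    using Lp_positive_operatorD(2)[OF K v v, of c 0] by simp
  then have "Lp_norm M p (K (\<lambda>x. c * v x)) = Lp_norm M p (\<lambda>x. c * K v x)"
    by (intro Lp_norm_cong_AE) auto
  then show ?thesis
    using p by (simp add: Lp_norm_cmult)
qed

text \<open>
  The Banach-Steinhaus theorem for positive operators, by a gliding hump without signs.  If it failed,
  there would be \<open>w\<^sub>n \<ge> 0\<close> of norm \<open>2\<^sup>-\<^sup>n\<close> and operators \<open>K\<^sub>n\<close> with \<open>\<parallel>K\<^sub>n w\<^sub>n\<parallel> > 2\<^sup>n\<close>.  The sum \<open>W\<close> of all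
  \<open>w\<^sub>n\<close> dominates each of them, so \<open>\<parallel>K\<^sub>n W\<parallel> > 2\<^sup>n\<close> by positivity, although \<open>K\<^sub>n W\<close> is bounded in \<open>n\<close>.
\<close>

lemma Lp_positive_operators_uniformly_bounded:
  assumes p: "1 \<le> p" and K: "\<And>i. i \<in> I \<Longrightarrow> Lp_positive_operator M p (K i)"
    and bdd: "\<And>v. v \<in> Lp_space M p \<Longrightarrow> \<exists>B. \<forall>i\<in>I. Lp_norm M p (K i v) \<le> B"
  shows "\<exists>C. 0 \<le> C \<and> (\<forall>i\<in>I. \<forall>v\<in>Lp_space M p. Lp_norm M p (K i v) \<le> C * Lp_norm M p v)"
proof (rule ccontr)
  assume no: "\<not> ?thesis"
  have "\<exists>i v. i \<in> I \<and> v \<in> Lp_space M p \<and> 4 ^ n * Lp_norm M p v < Lp_norm M p (K i v)" for n :: nat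
  proof -
    have "\<not> (0 \<le> (4::real) ^ n \<and> (\<forall>i\<in>I. \<forall>v\<in>Lp_space M p. Lp_norm M p (K i v) \<le> 4 ^ n * Lp_norm M p v))"
      using no by blast
    then show ?thesis
      by (auto simp: not_le)
  qed
  then have "\<forall>n::nat. \<exists>i v. i \<in> I \<and> v \<in> Lp_space M p \<and> 4 ^ n * Lp_norm M p v < Lp_norm M p (K i v)"
    by blast
  then obtain i v where i: "\<And>n. i n \<in> I" and v: "\<And>n::nat. v n \<in> Lp_space M p"
    and big: "\<And>n. 4 ^ n * Lp_norm M p (v n) < Lp_norm M p (K (i n) (v n))"
    by metis
  have pos: "0 < Lp_norm M p (v n)" for n
  proof -
    obtain C where "Lp_norm M p (K (i n) (v n)) \<le> C * Lp_norm M p (v n)"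
      using Lp_positive_operatorD(3)[OF K[OF i[of n]]] v by blast
    then have "Lp_norm M p (v n) \<noteq> 0"
      using big[of n] by auto
    then show ?thesis
      using Lp_norm_nonneg[of M p "v n"] by linarith
  qed
  define c where "c n = (1 / 2) ^ n / Lp_norm M p (v n)" for n
  define w where "w n x = c n * \<bar>v n x\<bar>" for n x
  have c: "0 < c n" for n
    using pos by (simp add: c_def)
  have w: "w n \<in> Lp_space M p" for n
    unfolding w_def by (intro Lp_space_cmult Lp_space_abs v)
  have "Lp_norm M p (w n) = (1 / 2) ^ n" for n
  proof -
    have "Lp_norm M p (w n) = c n * Lp_norm M p (\<lambda>x. \<bar>v n x\<bar>)"
      using p c[of n] unfolding w_def by (simp add: Lp_norm_cmult)
    also have "Lp_norm M p (\<lambda>x. \<bar>v n x\<bar>) = Lp_norm M p (v n)"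
      by (simp add: Lp_norm_def)
    finally show ?thesis
      using pos[of n] by (simp add: c_def)
  qed
  then have sw: "summable (\<lambda>n. Lp_norm M p (w n))"
    by simp
  obtain W where W: "W \<in> Lp_space M p" "AE x in M. (\<lambda>k. w k x) sums W x"
    by (rule Lp_series[OF p w sw]) (rule that)
  obtain B where B: "\<And>j. j \<in> I \<Longrightarrow> Lp_norm M p (K j W) \<le> B"
    using bdd[OF W(1)] by blast
  have "2 ^ n \<le> B" for n
  proof -
    have cv: "(\<lambda>x. c n * v n x) \<in> Lp_space M p"
      by (intro Lp_space_cmult v)
    have "2 ^ n = c n * (4 ^ n * Lp_norm M p (v n))"
      using pos[of n] by (simp add: c_def power_mult_distrib[symmetric])
    also have "\<dots> \<le> c n * Lp_norm M p (K (i n) (v n))"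
      using big[of n] c[of n] by (intro mult_left_mono) auto
    also have "\<dots> = Lp_norm M p (K (i n) (\<lambda>x. c n * v n x))"
      using c[of n] by (simp add: Lp_positive_operator_cmult[OF p K[OF i] v])
    also have "\<dots> \<le> Lp_norm M p (K (i n) W)"
    proof (rule Lp_positive_operator_mono[OF p K[OF i] cv W(1)])
      show "AE x in M. \<bar>c n * v n x\<bar> \<le> W x"
        using W(2)
      proof eventually_elim
        case (elim x)
        have "w n x \<le> W x"
          using c sum_le_suminf[OF sums_summable[OF elim], of "{n}"] sums_unique[OF elim]
          by (auto simp: w_def less_imp_le)
        then show ?case
          using c[of n] by (simp add: w_def abs_mult)
      qed
    qed
    also have "\<dots> \<le> B"
      by (intro B i)
    finally show ?thesis .
  qed
  moreover obtain n :: nat where "B < 2 ^ n"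
    using real_arch_pow[of 2 B] by auto
  ultimately show False
    by (meson not_le)
qed

section \<open>The Bochner integral\<close>

lemma (in finite_measure) Lp_simple_integral_eq:
  assumes S: "simple_function M S"
  shows "Lp_simple_integral M S x = (\<integral>s. S s x \<partial>M)" and "integrable M (\<lambda>s. S s x)"
proof -
  have S': "simple_function M (\<lambda>s. S s x)"
    by (rule simple_function_compose1[OF S])
  have b: "Bochner_Integration.simple_bochner_integrable M (\<lambda>s. S s x)"
    using S' by (simp add: simple_bochner_integrable.simps)
  show "integrable M (\<lambda>s. S s x)"
    using has_bochner_integral_simple_bochner_integrable[OF b] by (rule integrable.intros)
  have "(\<integral>s. S s x \<partial>M) = Bochner_Integration.simple_bochner_integral M (\<lambda>s. S s x)"
    using b by (rule simple_bochner_integrable_eq_integral[symmetric])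
  also have "\<dots> = (\<Sum>y\<in>S ` space M. measure M {s\<in>space M. S s = y} *\<^sub>R y x)"
    by (rule simple_bochner_integral_partition[OF b S]) auto
  finally show "Lp_simple_integral M S x = (\<integral>s. S s x \<partial>M)"
    by (simp add: Lp_simple_integral_def)
qed

lemma Lp_simple_integral_in_space:
  assumes "1 \<le> p" "\<And>s. s \<in> space N \<Longrightarrow> S s \<in> Lp_space M p"
  shows "Lp_simple_integral N S \<in> Lp_space M p"
  unfolding Lp_simple_integral_def
  by (intro Lp_space_sum assms Lp_space_cmult) (use assms in auto)

lemma (in finite_measure) Lp_norm_simple_integral:
  assumes p: "1 \<le> p" and S: "simple_function M S" "\<And>s. s \<in> space M \<Longrightarrow> S s \<in> Lp_space D p"
  shows "Lp_norm D p (Lp_simple_integral M S) \<le> (\<integral>s. Lp_norm D p (S s) \<partial>M)"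
proof -
  have S': "simple_function M (\<lambda>s. Lp_norm D p (S s))"
    by (rule simple_function_compose1[OF S(1)])
  have b: "Bochner_Integration.simple_bochner_integrable M (\<lambda>s. Lp_norm D p (S s))"
    using S' by (simp add: simple_bochner_integrable.simps)
  have "Lp_norm D p (Lp_simple_integral M S)
      \<le> (\<Sum>y\<in>S ` space M. Lp_norm D p (\<lambda>x. measure M {s\<in>space M. S s = y} * y x))"
    unfolding Lp_simple_integral_def by (intro Lp_norm_sum p Lp_space_cmult) (use S in auto)
  also have "\<dots> = (\<Sum>y\<in>S ` space M. measure M {s\<in>space M. S s = y} *\<^sub>R Lp_norm D p y)"
    using p by (simp add: Lp_norm_cmult)
  also have "\<dots> = Bochner_Integration.simple_bochner_integral M (\<lambda>s. Lp_norm D p (S s))"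
    by (rule simple_bochner_integral_partition[OF b S(1), symmetric]) auto
  also have "\<dots> = (\<integral>s. Lp_norm D p (S s) \<partial>M)"
    using b by (rule simple_bochner_integrable_eq_integral)
  finally show ?thesis .
qed

lemma (in finite_measure) Lp_dist_simple_integral:
  assumes p: "1 \<le> p" and S: "simple_function M S" "\<And>s. s \<in> space M \<Longrightarrow> S s \<in> Lp_space D p"
    and R: "simple_function M R" "\<And>s. s \<in> space M \<Longrightarrow> R s \<in> Lp_space D p"
  shows "ennreal (Lp_dist D p (Lp_simple_integral M S) (Lp_simple_integral M R))
    \<le> (\<integral>\<^sup>+s. ennreal (Lp_dist D p (S s) (R s)) \<partial>M)"
proof -
  let ?D = "\<lambda>s x. S s x - R s x"
  have D: "simple_function M ?D"
    by (rule simple_function_compose2[OF S(1) R(1), of "\<lambda>u v x. u x - v x"])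
  have D': "simple_function M (\<lambda>s. Lp_norm D p (?D s))"
    by (rule simple_function_compose1[OF D])
  have b: "Bochner_Integration.simple_bochner_integrable M (\<lambda>s. Lp_norm D p (?D s))"
    using D' by (simp add: simple_bochner_integrable.simps)
  have i: "integrable M (\<lambda>s. Lp_norm D p (?D s))"
    using has_bochner_integral_simple_bochner_integrable[OF b] by (rule integrable.intros)
  have "(\<lambda>x. Lp_simple_integral M S x - Lp_simple_integral M R x) = Lp_simple_integral M ?D"
    by (simp add: fun_eq_iff Lp_simple_integral_eq[OF S(1)] Lp_simple_integral_eq[OF R(1)]
        Lp_simple_integral_eq[OF D])
  then have "Lp_dist D p (Lp_simple_integral M S) (Lp_simple_integral M R) \<le> (\<integral>s. Lp_norm D p (?D s) \<partial>M)"
    unfolding Lp_dist_def using Lp_norm_simple_integral[OF p D, of D] S R p by (simp add: Lp_space_diff)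
  then show ?thesis
    using nn_integral_eq_integral[OF i] by (simp add: Lp_dist_def ennreal_leI)
qed

text \<open>The distance of a strongly measurable function from a simple one is a limit of measurable
  functions only almost everywhere, so it need not be measurable itself.  Its measurable version \<open>h\<close>
  makes the additivity of the integral available.\<close>

lemma Lp_strongly_measurable_dist:
  assumes p: "1 \<le> p" and G: "Lp_strongly_measurable D p N G"
    and S: "simple_function N S" "\<And>s. s \<in> space N \<Longrightarrow> S s \<in> Lp_space D p"
  obtains h where "h \<in> borel_measurable N" "AE s in N. h s = ennreal (Lp_dist D p (G s) (S s))"
proof -
  obtain R where R: "\<And>i. simple_function N (R i)" "\<And>i s. s \<in> space N \<Longrightarrow> R i s \<in> Lp_space D p"
    "AE s in N. (\<lambda>i::nat. Lp_dist D p (G s) (R i s)) \<longlonglongrightarrow> 0"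
    and G': "\<And>s. s \<in> space N \<Longrightarrow> G s \<in> Lp_space D p"
    using G unfolding Lp_strongly_measurable_def by auto
  define h where "h s = liminf (\<lambda>i. ennreal (Lp_dist D p (R i s) (S s)))" for s
  have "(\<lambda>s. ennreal (Lp_dist D p (R i s) (S s))) \<in> borel_measurable N" for i
    by (intro borel_measurable_simple_function simple_function_compose2[OF R(1) S(1)])
  then have m: "h \<in> borel_measurable N"
    unfolding h_def by measurable
  have ae: "AE s in N. h s = ennreal (Lp_dist D p (G s) (S s))"
    using R(3) AE_space
  proof eventually_elim
    case (elim s)
    have "(\<lambda>i. Lp_dist D p (R i s) (S s) - Lp_dist D p (G s) (S s)) \<longlonglongrightarrow> 0"
    proof (rule Lim_null_comparison[OF always_eventually elim(1)], intro allI)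
      fix i
      show "norm (Lp_dist D p (R i s) (S s) - Lp_dist D p (G s) (S s)) \<le> Lp_dist D p (G s) (R i s)"
        using Lp_dist_triangle[OF p R(2)[OF elim(2)] G'[OF elim(2)] S(2)[OF elim(2)], of i]
          Lp_dist_triangle[OF p G'[OF elim(2)] R(2)[OF elim(2)] S(2)[OF elim(2)], of i]
        by (auto simp: Lp_dist_commute[of D p "R i s" "G s"])
    qed
    then have "(\<lambda>i. ennreal (Lp_dist D p (R i s) (S s))) \<longlonglongrightarrow> ennreal (Lp_dist D p (G s) (S s))"
      by (intro tendsto_ennrealI) (simp add: LIM_zero_iff)
    then show ?case
      unfolding h_def by (intro lim_imp_Liminf) auto
  qed
  show thesis
    using m ae by (rule that)
qed

text \<open>The rate \<open>2\<^sup>-\<^sup>i\<close> makes the successive distances of the simple integrals summable, which is the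
  form of completeness provided by \<open>Lp_limit_of_fast_Cauchy\<close>.\<close>

lemma (in finite_measure) has_Lp_integralI_fast:
  assumes p: "1 \<le> p" and G: "Lp_strongly_measurable D p M G"
    and S: "\<And>i::nat. simple_function M (S i)" "\<And>i s. s \<in> space M \<Longrightarrow> S i s \<in> Lp_space D p"
    and le: "\<And>i. (\<integral>\<^sup>+s. ennreal (Lp_dist D p (G s) (S i s)) \<partial>M) \<le> ennreal ((1 / 2) ^ i)"
  obtains v where "has_Lp_integral D p M G v"
proof -
  have G': "\<And>s. s \<in> space M \<Longrightarrow> G s \<in> Lp_space D p"
    using G by (auto simp: Lp_strongly_measurable_def)
  have "\<exists>h. h \<in> borel_measurable M \<and> (AE s in M. h s = ennreal (Lp_dist D p (G s) (S i s)))" for i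
    by (rule Lp_strongly_measurable_dist[OF p G S(1,2)[where i=i]]) (assumption, intro exI conjI)
  then obtain h where [measurable]: "\<And>i. h i \<in> borel_measurable M"
    and h: "\<And>i. AE s in M. h i s = ennreal (Lp_dist D p (G s) (S i s))"
    by metis
  let ?I = "\<lambda>i. Lp_simple_integral M (S i)"
  have I: "?I i \<in> Lp_space D p" for i
    by (intro Lp_simple_integral_in_space p S)
  have hi: "(\<integral>\<^sup>+s. h i s \<partial>M) \<le> ennreal ((1 / 2) ^ i)" for i
    using le[of i] nn_integral_cong_AE[OF h[of i]] by simp
  have d: "Lp_dist D p (?I (Suc i)) (?I i) \<le> 2 * (1 / 2) ^ i" for i
  proof -
    have "ennreal (Lp_dist D p (?I (Suc i)) (?I i)) \<le> (\<integral>\<^sup>+s. ennreal (Lp_dist D p (S (Suc i) s) (S i s)) \<partial>M)"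
      by (intro Lp_dist_simple_integral p S)
    also have "\<dots> \<le> (\<integral>\<^sup>+s. h (Suc i) s + h i s \<partial>M)"
    proof (rule nn_integral_mono_AE)
      show "AE s in M. ennreal (Lp_dist D p (S (Suc i) s) (S i s)) \<le> h (Suc i) s + h i s"
        using h[of i] h[of "Suc i"] AE_space
      proof eventually_elim
        case (elim s)
        show ?case
          using Lp_dist_triangle[OF p S(2)[OF elim(3)] G'[OF elim(3)] S(2)[OF elim(3)], of "Suc i" i]
          by (simp add: elim ennreal_plus[symmetric] Lp_dist_commute[of D p "S (Suc i) s" "G s"] del: ennreal_plus)
      qed
    qed
    also have "\<dots> = (\<integral>\<^sup>+s. h (Suc i) s \<partial>M) + (\<integral>\<^sup>+s. h i s \<partial>M)"
      by (intro nn_integral_add) auto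
    also have "\<dots> \<le> ennreal ((1 / 2) ^ Suc i) + ennreal ((1 / 2) ^ i)"
      by (intro add_mono hi)
    also have "\<dots> \<le> ennreal (2 * (1 / 2) ^ i)"
      by (simp add: ennreal_plus[symmetric] del: ennreal_plus)
    finally show ?thesis
      by simp
  qed
  have sI: "summable (\<lambda>i. Lp_dist D p (?I (Suc i)) (?I i))"
    by (rule summable_comparison_test_ev[where g="\<lambda>i. 2 * (1 / 2) ^ i"])
       (use d in \<open>auto intro!: summable_mult summable_geometric\<close>)
  obtain v where v: "v \<in> Lp_space D p" "(\<lambda>i. Lp_dist D p (?I i) v) \<longlonglongrightarrow> 0"
    by (rule Lp_limit_of_fast_Cauchy[OF p I sI]) (rule that)
  have "(\<lambda>i. ennreal ((1 / 2) ^ i)) \<longlonglongrightarrow> ennreal 0"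
    by (intro tendsto_ennrealI LIMSEQ_power_zero) simp
  then have l: "(\<lambda>i. \<integral>\<^sup>+s. ennreal (Lp_dist D p (G s) (S i s)) \<partial>M) \<longlonglongrightarrow> ennreal 0"
    by (rule tendsto_sandwich[OF _ _ tendsto_const, rotated 2]) (use le in auto)
  have "Lp_simple_integrable D p M (S i)" for i
    using S by (simp add: Lp_simple_integrable_def)
  then have "has_Lp_integral D p M G v"
    unfolding has_Lp_integral_def using G v l by (intro conjI exI[of _ S]) auto
  then show thesis
    by (rule that)
qed

text \<open>
  A continuous functional commutes with the Bochner integral.  By Hoelder's inequality the images
  \<open>\<langle>g, S\<^sub>i\<rangle>\<close> of the simple approximations of \<open>G\<close> converge in mean to \<open>\<langle>g, G\<rangle>\<close>, so they
  determine its scalar integral.  The measurable version \<open>a\<close> of \<open>\<langle>g, G\<rangle>\<close> is the limit of the images of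
  the simple functions that converge to \<open>G\<close> almost everywhere.
\<close>

lemma (in finite_measure) Lp_pairing_has_Lp_integral:
  assumes p: "1 < p" and g: "g \<in> Lp_space D (conj_exp p)" and G: "has_Lp_integral D p M G v"
    and pos: "\<And>s. s \<in> space M \<Longrightarrow> 0 \<le> Lp_pairing D g (G s)"
  shows "ennreal (Lp_pairing D g v) = (\<integral>\<^sup>+s. ennreal (Lp_pairing D g (G s)) \<partial>M)"
proof -
  have p1: "1 \<le> p"
    using p by simp
  have sm: "Lp_strongly_measurable D p M G"
    using G by (simp add: has_Lp_integral_def)
  then obtain R where R: "\<And>i. simple_function M (R i)" "\<And>i s. s \<in> space M \<Longrightarrow> R i s \<in> Lp_space D p"
    "AE s in M. (\<lambda>i::nat. Lp_dist D p (G s) (R i s)) \<longlonglongrightarrow> 0"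
    and G': "\<And>s. s \<in> space M \<Longrightarrow> G s \<in> Lp_space D p"
    unfolding Lp_strongly_measurable_def by auto
  obtain S where S: "\<And>i. Lp_simple_integrable D p M (S i)"
    "(\<lambda>i::nat. \<integral>\<^sup>+s. ennreal (Lp_dist D p (G s) (S i s)) \<partial>M) \<longlonglongrightarrow> 0"
    "(\<lambda>i. Lp_dist D p (Lp_simple_integral M (S i)) v) \<longlonglongrightarrow> 0" and v: "v \<in> Lp_space D p"
    using G unfolding has_Lp_integral_def by auto
  have S': "simple_function M (S i)" "s \<in> space M \<Longrightarrow> S i s \<in> Lp_space D p" for i s
    using S(1)[of i] by (auto simp: Lp_simple_integrable_def)
  define a where "a s = lim (\<lambda>i. Lp_pairing D g (R i s))" for s
  have "(\<lambda>s. Lp_pairing D g (R i s)) \<in> borel_measurable M" for i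
    by (intro borel_measurable_simple_function simple_function_compose1[OF R(1)])
  then have [measurable]: "a \<in> borel_measurable M"
    unfolding a_def by measurable
  have a: "AE s in M. a s = Lp_pairing D g (G s)"
    using R(3) AE_space
  proof eventually_elim
    case (elim s)
    have "(\<lambda>i. Lp_pairing D g (R i s)) \<longlonglongrightarrow> Lp_pairing D g (G s)"
      using tendsto_Lp_pairing[OF p g R(2)[OF elim(2)] G'[OF elim(2)]] elim(1)
      by (simp add: Lp_dist_commute)
    then show ?case
      unfolding a_def by (rule limI)
  qed
  have b: "Bochner_Integration.simple_bochner_integrable M (\<lambda>s. Lp_pairing D g (S i s))" for i
    using simple_function_compose1[OF S'(1)] by (simp add: simple_bochner_integrable.simps)
  have "has_bochner_integral M a (Lp_pairing D g v)"
  proof (rule has_bochner_integral.intros[OF _ b])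
    let ?g = "Lp_norm D (conj_exp p) g"
    have bound0: "(\<lambda>i. ennreal ?g * (\<integral>\<^sup>+s. ennreal (Lp_dist D p (G s) (S i s)) \<partial>M)) \<longlonglongrightarrow> 0"
      using ennreal_tendsto_cmult[OF _ S(2), of "ennreal ?g"] by simp
    have bound: "(\<integral>\<^sup>+s. ennreal (norm (a s - Lp_pairing D g (S i s))) \<partial>M)
        \<le> ennreal ?g * (\<integral>\<^sup>+s. ennreal (Lp_dist D p (G s) (S i s)) \<partial>M)" for i
    proof -
      obtain h where [measurable]: "h \<in> borel_measurable M"
        and h: "AE s in M. h s = ennreal (Lp_dist D p (G s) (S i s))"
        by (rule Lp_strongly_measurable_dist[OF p1 sm S'(1,2)[where i=i]]) (assumption, rule that)
      have "(\<integral>\<^sup>+s. ennreal (norm (a s - Lp_pairing D g (S i s))) \<partial>M) \<le> (\<integral>\<^sup>+s. ennreal ?g * h s \<partial>M)"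
      proof (rule nn_integral_mono_AE)
        show "AE s in M. ennreal (norm (a s - Lp_pairing D g (S i s))) \<le> ennreal ?g * h s"
          using a h AE_space
        proof eventually_elim
          case (elim s)
          then show ?case
            using Lp_pairing_dist[OF p g G'[OF elim(3)] S'(2)[OF elim(3)], of i]
            by (simp add: ennreal_mult'[symmetric])
        qed
      qed
      also have "\<dots> = ennreal ?g * (\<integral>\<^sup>+s. h s \<partial>M)"
        by (rule nn_integral_cmult) simp
      also have "(\<integral>\<^sup>+s. h s \<partial>M) = (\<integral>\<^sup>+s. ennreal (Lp_dist D p (G s) (S i s)) \<partial>M)"
        by (rule nn_integral_cong_AE[OF h])
      finally show ?thesis .
    qed
    show "(\<lambda>i. \<integral>\<^sup>+s. ennreal (norm (a s - Lp_pairing D g (S i s))) \<partial>M) \<longlonglongrightarrow> 0"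
      by (rule tendsto_sandwich[OF _ _ tendsto_const bound0]) (use bound in \<open>auto intro!: always_eventually\<close>)
    have eq: "Bochner_Integration.simple_bochner_integral M (\<lambda>s. Lp_pairing D g (S i s)) = Lp_pairing D g (Lp_simple_integral M (S i))" for i
    proof -
      have "Lp_pairing D g (Lp_simple_integral M (S i))
          = (\<integral>x. (\<Sum>y\<in>S i ` space M. measure M {s\<in>space M. S i s = y} * (g x * y x)) \<partial>D)"
        unfolding Lp_pairing_def Lp_simple_integral_def
        by (intro Bochner_Integration.integral_cong) (auto simp: sum_distrib_left ac_simps)
      also have "\<dots> = (\<Sum>y\<in>S i ` space M. measure M {s\<in>space M. S i s = y} * Lp_pairing D g y)"
        unfolding Lp_pairing_def using S'(2)
        by (subst Bochner_Integration.integral_sum) (auto intro!: integrable_mult_right Lp_holder(1)[OF p g])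
      also have "\<dots> = Bochner_Integration.simple_bochner_integral M (\<lambda>s. Lp_pairing D g (S i s))"
        by (subst simple_bochner_integral_partition[OF b S'(1), where v="Lp_pairing D g"]) auto
      finally show ?thesis ..
    qed
    have "(\<lambda>i. Lp_pairing D g (Lp_simple_integral M (S i))) \<longlonglongrightarrow> Lp_pairing D g v"
      by (rule tendsto_Lp_pairing[OF p g _ v S(3)]) (intro Lp_simple_integral_in_space p1 S'(2))
    then show "(\<lambda>i. Bochner_Integration.simple_bochner_integral M (\<lambda>s. Lp_pairing D g (S i s))) \<longlonglongrightarrow> Lp_pairing D g v"
      unfolding eq .
  qed simp
  then have "integrable M a" "(\<integral>s. a s \<partial>M) = Lp_pairing D g v"
    by (auto simp: has_bochner_integral_iff)
  moreover have "AE s in M. 0 \<le> a s"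
    using a AE_space by eventually_elim (use pos in auto)
  ultimately have "ennreal (Lp_pairing D g v) = (\<integral>\<^sup>+s. ennreal (a s) \<partial>M)"
    using nn_integral_eq_integral[of M a] by simp
  also have "\<dots> = (\<integral>\<^sup>+s. ennreal (Lp_pairing D g (G s)) \<partial>M)"
    by (rule nn_integral_cong_AE) (use a in auto)
  finally show ?thesis .
qed

section \<open>Strongly continuous families of positive operators\<close>

definition Lp_strongly_continuous_on ::
  "'d measure \<Rightarrow> real \<Rightarrow> 'i::metric_space set \<Rightarrow> ('i \<Rightarrow> ('d \<Rightarrow> real) \<Rightarrow> 'd \<Rightarrow> real) \<Rightarrow> bool" where
  "Lp_strongly_continuous_on M p I K \<longleftrightarrow>
     (\<forall>y\<in>Lp_space M p. \<forall>s\<in>I. ((\<lambda>r. Lp_dist M p (K r y) (K s y)) \<longlongrightarrow> 0) (at s within I))"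

text \<open>At the limit point itself the distance is \<open>0\<close>, so the sequence may take the value \<open>s\<close>.\<close>

lemma Lp_strongly_continuous_onD:
  assumes "Lp_strongly_continuous_on M p I K" "y \<in> Lp_space M p" "s \<in> I" "\<And>n::nat. x n \<in> I" "x \<longlonglongrightarrow> s"
  shows "(\<lambda>n. Lp_dist M p (K (x n) y) (K s y)) \<longlonglongrightarrow> 0"
proof -
  have "continuous (at s within I) (\<lambda>r. Lp_dist M p (K r y) (K s y))"
    using assms(1-3) by (auto simp: Lp_strongly_continuous_on_def continuous_within)
  from continuous_within_tendsto_compose'[OF this assms(4,5)] show ?thesis
    by simp
qed

lemma Lp_strongly_continuous_on_subset:
  assumes "Lp_strongly_continuous_on M p I K" "J \<subseteq> I"
  shows "Lp_strongly_continuous_on M p J K"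
  using assms unfolding Lp_strongly_continuous_on_def by (meson subsetD tendsto_within_subset)

lemma Lp_strongly_continuous_on_section:
  assumes K: "Lp_strongly_continuous_on M p (A \<times> B) (\<lambda>(t, s). K t s)" and t: "t \<in> A"
  shows "Lp_strongly_continuous_on M p B (K t)"
  unfolding Lp_strongly_continuous_on_def
proof (intro ballI)
  fix y s assume y: "y \<in> Lp_space M p" and s: "s \<in> B"
  show "((\<lambda>r. Lp_dist M p (K t r y) (K t s y)) \<longlongrightarrow> 0) (at s within B)"
    unfolding tendsto_at_iff_sequentially o_def
    using Lp_strongly_continuous_onD[OF K y, of "(t, s)" "\<lambda>n. (t, x n)" for x] t s
    by (auto intro: tendsto_Pair[OF tendsto_const])
qed

text \<open>This real-valued function of two variables stands in for the \<open>L\<^sup>p\<close>-valued \<open>s \<mapsto> K\<^sub>s y\<close>: on a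
  compact set its boundedness gives that of \<open>K\<^sub>s y\<close>, and its uniform continuity near the diagonal, where
  it vanishes, gives that of \<open>K\<^sub>s y\<close>.\<close>

lemma Lp_dist_continuous_on:
  assumes p: "1 \<le> p" and K: "Lp_strongly_continuous_on M p I K" and y: "y \<in> Lp_space M p"
    and Ky: "\<And>s. s \<in> I \<Longrightarrow> K s y \<in> Lp_space M p"
  shows "continuous_on (I \<times> I) (\<lambda>(s, r). Lp_dist M p (K s y) (K r y))"
  unfolding continuous_on_sequentially o_def
proof (intro allI ballI impI, elim conjE)
  fix x a assume a: "a \<in> I \<times> I" and x: "\<forall>n::nat. x n \<in> I \<times> I" "x \<longlonglongrightarrow> a"
  let ?d = "\<lambda>u v. Lp_dist M p (K u y) (K v y)"
  have x': "fst (x n) \<in> I" "snd (x n) \<in> I" "fst a \<in> I" "snd a \<in> I" for n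
    using x(1) a by (auto simp: mem_Times_iff)
  have "(\<lambda>n. ?d (fst (x n)) (fst a) + ?d (snd (x n)) (snd a)) \<longlonglongrightarrow> 0 + 0"
    by (intro tendsto_add Lp_strongly_continuous_onD[OF K y] x' tendsto_fst tendsto_snd x(2))
  then have *: "(\<lambda>n. ?d (fst (x n)) (fst a) + ?d (snd (x n)) (snd a)) \<longlonglongrightarrow> 0"
    by simp
  have "(\<lambda>n. ?d (fst (x n)) (snd (x n)) - ?d (fst a) (snd a)) \<longlonglongrightarrow> 0"
  proof (rule Lim_null_comparison[OF always_eventually *], intro allI)
    fix n
    note t = Lp_dist_triangle[OF p Ky Ky Ky]
    have "?d (fst (x n)) (snd (x n)) \<le> ?d (fst (x n)) (fst a) + ?d (fst a) (snd (x n))"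
      "?d (fst a) (snd (x n)) \<le> ?d (fst a) (snd a) + ?d (snd a) (snd (x n))"
      "?d (fst a) (snd a) \<le> ?d (fst a) (fst (x n)) + ?d (fst (x n)) (snd a)"
      "?d (fst (x n)) (snd a) \<le> ?d (fst (x n)) (snd (x n)) + ?d (snd (x n)) (snd a)"
      by (intro t x')+
    then show "norm (?d (fst (x n)) (snd (x n)) - ?d (fst a) (snd a))
        \<le> ?d (fst (x n)) (fst a) + ?d (snd (x n)) (snd a)"
      using Lp_dist_commute[of M p "K (fst a) y" "K (fst (x n)) y"]
        Lp_dist_commute[of M p "K (snd a) y" "K (snd (x n)) y"]
      by (auto simp: abs_le_iff)
  qed
  then show "(\<lambda>n. case x n of (s, r) \<Rightarrow> ?d s r) \<longlonglongrightarrow> (case a of (s, r) \<Rightarrow> ?d s r)"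
    by (simp add: case_prod_beta LIM_zero_iff)
qed

lemma Lp_positive_operators_bounded_on_compact:
  assumes p: "1 \<le> p" and I: "compact I" and K: "\<And>s. s \<in> I \<Longrightarrow> Lp_positive_operator M p (K s)"
    and cont: "Lp_strongly_continuous_on M p I K"
  obtains C where "0 \<le> C" "\<And>s v. s \<in> I \<Longrightarrow> v \<in> Lp_space M p \<Longrightarrow> Lp_norm M p (K s v) \<le> C * Lp_norm M p v"
proof -
  have "\<exists>B. \<forall>s\<in>I. Lp_norm M p (K s v) \<le> B" if v: "v \<in> Lp_space M p" for v
  proof (cases "I = {}")
    case False
    then obtain a where a: "a \<in> I"
      by blast
    have Kv: "\<And>s. s \<in> I \<Longrightarrow> K s v \<in> Lp_space M p"
      using Lp_positive_operatorD(1)[OF K v] .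
    have "compact ((\<lambda>(s, r). Lp_dist M p (K s v) (K r v)) ` (I \<times> I))"
      by (intro compact_continuous_image Lp_dist_continuous_on[OF p cont v Kv] compact_Times I)
    then have "bounded ((\<lambda>(s, r). Lp_dist M p (K s v) (K r v)) ` (I \<times> I))"
      by (rule compact_imp_bounded)
    then obtain B where "\<forall>x\<in>(\<lambda>(s, r). Lp_dist M p (K s v) (K r v)) ` (I \<times> I). \<bar>x\<bar> \<le> B"
      unfolding bounded_real by blast
    then have B: "\<And>s r. s \<in> I \<Longrightarrow> r \<in> I \<Longrightarrow> Lp_dist M p (K s v) (K r v) \<le> B"
      by force
    have "Lp_norm M p (K s v) \<le> Lp_norm M p (K a v) + B" if "s \<in> I" for s
      using Lp_norm_le_dist[OF p Kv[OF that] Kv[OF a]] B[OF that a] by simp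
    then show ?thesis
      by blast
  qed auto
  from Lp_positive_operators_uniformly_bounded[OF p K this] show thesis
    using that by blast
qed

section \<open>Dyadic grids\<close>

text \<open>Rounding down keeps the argument in every time set, whether or not \<open>T\<close> is finite.\<close>

definition dyadic :: "nat \<Rightarrow> real \<Rightarrow> real" where
  "dyadic k t = of_int \<lfloor>t * 2 ^ k\<rfloor> / 2 ^ k"

lemma dyadic_le: "dyadic k t \<le> t"
  by (simp add: dyadic_def divide_le_eq)

lemma dyadic_nonneg: "0 \<le> t \<Longrightarrow> 0 \<le> dyadic k t"
  by (simp add: dyadic_def)

lemma dyadic_dist: "\<bar>t - dyadic k t\<bar> \<le> (1 / 2) ^ k"
proof -
  have "t * 2 ^ k \<le> of_int \<lfloor>t * 2 ^ k\<rfloor> + 1"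
    by linarith
  then have "t \<le> (of_int \<lfloor>t * 2 ^ k\<rfloor> + 1) / 2 ^ k"
    by (simp add: le_divide_eq)
  then show ?thesis
    using dyadic_le[of k t] by (simp add: dyadic_def add_divide_distrib power_one_over)
qed

lemma dyadic_tendsto: "(\<lambda>k. dyadic k t) \<longlonglongrightarrow> t"
proof -
  have "(\<lambda>k. dyadic k t - t) \<longlonglongrightarrow> 0"
    by (rule Lim_null_comparison[where g="\<lambda>k. (1 / 2) ^ k"])
       (use dyadic_dist in \<open>auto simp: abs_minus_commute intro!: LIMSEQ_power_zero\<close>)
  then show ?thesis
    by (simp add: LIM_zero_iff)
qed

lemma dyadic_measurable [measurable]: "dyadic k \<in> borel_measurable borel"
  unfolding dyadic_def by measurable

lemma simple_function_dyadic:
  assumes "sets N = sets (restrict_space borel {0..t})"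
  shows "simple_function N (dyadic k)"
proof (rule simple_function_borel_measurable)
  have sp: "space N = {0..t}"
    using sets_eq_imp_space_eq[OF assms] by (simp add: space_restrict_space)
  show "dyadic k \<in> borel_measurable N"
    unfolding measurable_cong_sets[OF assms refl] by (intro measurable_restrict_space1 dyadic_measurable)
  have "dyadic k ` space N \<subseteq> (\<lambda>i. of_int i / 2 ^ k) ` {0..\<lfloor>t * 2 ^ k\<rfloor>}"
    unfolding sp dyadic_def by (auto intro!: imageI floor_mono)
  then show "finite (dyadic k ` space N)"
    by (rule finite_subset) simp
qed

section \<open>Integrals of operators along a density\<close>

lemma Lp_dyadic_uniform:
  assumes p: "1 \<le> p" and K: "\<And>s. s \<in> {0..t} \<Longrightarrow> Lp_positive_operator M p (K s)"
    and cont: "Lp_strongly_continuous_on M p {0..t} K" and y: "y \<in> Lp_space M p" and e: "0 < e"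
  shows "\<forall>\<^sub>F k in sequentially. \<forall>s\<in>{0..t}. Lp_dist M p (K s y) (K (dyadic k s) y) \<le> e"
proof -
  let ?F = "\<lambda>(s, r). Lp_dist M p (K s y) (K r y)"
  have "uniformly_continuous_on ({0..t} \<times> {0..t}) ?F"
    by (intro compact_uniformly_continuous Lp_dist_continuous_on p cont y compact_Times
        Lp_positive_operatorD(1)[OF K]) auto
  then obtain d where d: "0 < d" "\<And>a b. a \<in> {0..t} \<times> {0..t} \<Longrightarrow> b \<in> {0..t} \<times> {0..t} \<Longrightarrow>
      dist b a < d \<Longrightarrow> dist (?F b) (?F a) < e"
    using e unfolding uniformly_continuous_on_def by metis
  have "(\<lambda>k. (1 / 2 :: real) ^ k) \<longlonglongrightarrow> 0"
    by (intro LIMSEQ_power_zero) simp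
  then have "\<forall>\<^sub>F k in sequentially. (1 / 2) ^ k < d"
    using d(1) by (rule order_tendstoD)
  then show ?thesis
  proof eventually_elim
    case (elim k)
    show ?case
    proof
      fix s assume s: "s \<in> {0..t}"
      then have g: "dyadic k s \<in> {0..t}"
        using dyadic_le[of k s] dyadic_nonneg[of s k] by auto
      have "dist (s, dyadic k s) (s, s) < d"
        using dyadic_dist[of s k] elim by (simp add: dist_Pair_Pair dist_real_def abs_minus_commute)
      from d(2)[OF _ _ this] s g show "Lp_dist M p (K s y) (K (dyadic k s) y) \<le> e"
        by (simp add: dist_real_def)
    qed
  qed
qed

text \<open>A simple function has finitely many values, so one grid serves all of them.  Rounding \<open>s\<close> to
  this grid turns \<open>K\<^sub>s (S s)\<close> into a simple function.\<close>

lemma operator_simple_approx: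
  fixes N :: "real measure"
  assumes p: "1 \<le> p" and N: "sets N = sets (restrict_space borel {0..t})"
    and K: "\<And>s. s \<in> {0..t} \<Longrightarrow> Lp_positive_operator M p (K s)"
    and cont: "Lp_strongly_continuous_on M p {0..t} K" and e: "0 < e"
    and S: "simple_function N S" "\<And>s. s \<in> space N \<Longrightarrow> S s \<in> Lp_space M p"
  shows "\<exists>R. simple_function N R \<and> (\<forall>s\<in>space N. R s \<in> Lp_space M p) \<and>
    (\<forall>s\<in>space N. Lp_dist M p (K s (S s)) (R s) \<le> e)"
proof -
  have sp: "space N = {0..t}"
    using sets_eq_imp_space_eq[OF N] by (simp add: space_restrict_space)
  have "\<forall>\<^sub>F k in sequentially. \<forall>y\<in>S ` space N. \<forall>s\<in>{0..t}. Lp_dist M p (K s y) (K (dyadic k s) y) \<le> e"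
    by (rule eventually_ball_finite[OF simple_functionD(1)[OF S(1)]])
       (use Lp_dyadic_uniform[OF p K cont _ e] S(2) in blast)
  then obtain k where k: "\<And>y s. y \<in> S ` space N \<Longrightarrow> s \<in> {0..t} \<Longrightarrow> Lp_dist M p (K s y) (K (dyadic k s) y) \<le> e"
    using eventually_happens'[OF sequentially_bot] by blast
  have g: "dyadic k s \<in> {0..t}" if "s \<in> {0..t}" for s
    using that dyadic_le[of k s] dyadic_nonneg[of s k] by auto
  show ?thesis
  proof (intro exI[of _ "\<lambda>s. K (dyadic k s) (S s)"] conjI ballI)
    show "simple_function N (\<lambda>s. K (dyadic k s) (S s))"
      by (rule simple_function_compose2[OF simple_function_dyadic[OF N] S(1)])
    show "K (dyadic k s) (S s) \<in> Lp_space M p" if "s \<in> space N" for s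
      using that g sp by (intro Lp_positive_operatorD(1)[OF K] S(2)) auto
    show "Lp_dist M p (K s (S s)) (K (dyadic k s) (S s)) \<le> e" if "s \<in> space N" for s
      using that sp by (intro k) auto
  qed
qed

text \<open>
  If \<open>Y\<close> is close to \<open>r s\<close> and \<open>Z\<close> is close to \<open>K\<^sub>s Y\<close>, then \<open>Z\<close> is close to \<open>K\<^sub>s (r s)\<close>, uniformly in \<open>s\<close>.
  With the uniform bound \<open>C\<close> of the operators the approximations of \<open>r\<close> are thus carried over to
  \<open>K\<^sub>s (r s)\<close>: those converging almost everywhere give strong measurability, those converging in mean
  give the integral.
\<close>

lemma operator_has_Lp_integral:
  fixes M :: "real measure"
  assumes fin: "finite_measure M" and p: "1 \<le> p" and N: "sets M = sets (restrict_space borel {0..t})"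
    and K: "\<And>s. s \<in> {0..t} \<Longrightarrow> Lp_positive_operator D p (K s)"
    and cont: "Lp_strongly_continuous_on D p {0..t} K"
    and r: "has_Lp_integral D p M r w"
  obtains v where "has_Lp_integral D p M (\<lambda>s. K s (r s)) v"
proof -
  interpret finite_measure M by (rule fin)
  have sp: "space M = {0..t}"
    using sets_eq_imp_space_eq[OF N] by (simp add: space_restrict_space)
  have rm: "Lp_strongly_measurable D p M r"
    using r by (simp add: has_Lp_integral_def)
  obtain R where R: "\<And>i. simple_function M (R i)" "\<And>i s. s \<in> space M \<Longrightarrow> R i s \<in> Lp_space D p"
    "AE s in M. (\<lambda>i::nat. Lp_dist D p (r s) (R i s)) \<longlonglongrightarrow> 0"
    and r': "\<And>s. s \<in> space M \<Longrightarrow> r s \<in> Lp_space D p"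
    using rm unfolding Lp_strongly_measurable_def by auto
  obtain S where S: "\<And>i. Lp_simple_integrable D p M (S i)"
    "(\<lambda>i::nat. \<integral>\<^sup>+s. ennreal (Lp_dist D p (r s) (S i s)) \<partial>M) \<longlonglongrightarrow> 0"
    using r unfolding has_Lp_integral_def by auto
  have S': "simple_function M (S i)" "s \<in> space M \<Longrightarrow> S i s \<in> Lp_space D p" for i s
    using S(1)[of i] by (auto simp: Lp_simple_integrable_def)
  obtain C where C: "0 \<le> C" "\<And>s v. s \<in> {0..t} \<Longrightarrow> v \<in> Lp_space D p \<Longrightarrow> Lp_norm D p (K s v) \<le> C * Lp_norm D p v"
    by (rule Lp_positive_operators_bounded_on_compact[where I="{0..t}" and K=K, OF p _ _ cont])
       (use K that compact_Icc in auto)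
  have Ksp: "K s u \<in> Lp_space D p" if "s \<in> space M" "u \<in> Lp_space D p" for s u
    using Lp_positive_operatorD(1)[OF K] that sp by auto
  have dist: "Lp_dist D p (K s (r s)) Z \<le> C * Lp_dist D p (r s) Y + e"
    if "s \<in> space M" "Y \<in> Lp_space D p" "Z \<in> Lp_space D p" "Lp_dist D p (K s Y) Z \<le> e" for s Y Z e
  proof -
    have "Lp_dist D p (K s (r s)) Z \<le> Lp_dist D p (K s (r s)) (K s Y) + Lp_dist D p (K s Y) Z"
      by (intro Lp_dist_triangle p Ksp that r')
    also have "Lp_dist D p (K s (r s)) (K s Y) \<le> C * Lp_dist D p (r s) Y"
    proof -
      have s: "s \<in> {0..t}"
        using that(1) sp by simp
      show ?thesis
        unfolding Lp_positive_operator_dist[OF p K[OF s] r'[OF that(1)] that(2)] Lp_dist_def[of D p "r s"]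
        by (rule C(2)[OF s Lp_space_diff[OF p r'[OF that(1)] that(2)]])
    qed
    finally show ?thesis
      using that(4) by simp
  qed
  \<comment> \<open>Approximations of \<open>r\<close> almost everywhere give strong measurability.\<close>
  have "\<exists>Q. simple_function M Q \<and> (\<forall>s\<in>space M. Q s \<in> Lp_space D p) \<and>
      (\<forall>s\<in>space M. Lp_dist D p (K s (R i s)) (Q s) \<le> (1 / 2) ^ i)" for i
    by (rule operator_simple_approx[OF p N K cont _ R(1,2)]) auto
  then obtain Q where Q: "\<And>i. simple_function M (Q i)" "\<And>i s. s \<in> space M \<Longrightarrow> Q i s \<in> Lp_space D p"
    "\<And>i s. s \<in> space M \<Longrightarrow> Lp_dist D p (K s (R i s)) (Q i s) \<le> (1 / 2) ^ i"
    by metis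
  have "AE s in M. (\<lambda>i. Lp_dist D p (K s (r s)) (Q i s)) \<longlonglongrightarrow> 0"
    using R(3) AE_space
  proof eventually_elim
    case (elim s)
    have "(\<lambda>i. C * Lp_dist D p (r s) (R i s) + (1 / 2) ^ i) \<longlonglongrightarrow> C * 0 + 0"
      by (intro tendsto_intros elim LIMSEQ_power_zero) simp
    then have l: "(\<lambda>i. C * Lp_dist D p (r s) (R i s) + (1 / 2) ^ i) \<longlonglongrightarrow> 0"
      by simp
    show ?case
      by (rule Lim_null_comparison[OF always_eventually l])
         (use dist[OF elim(2) R(2)[OF elim(2)] Q(2)[OF elim(2)] Q(3)[OF elim(2)]] in auto)
  qed
  then have sm: "Lp_strongly_measurable D p M (\<lambda>s. K s (r s))"
    unfolding Lp_strongly_measurable_def using Q(1,2) Ksp r' by (intro conjI exI[of _ Q]) auto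
  \<comment> \<open>Approximations of \<open>r\<close> in mean, with half of the error from \<open>r\<close> and half from the grid.
    The denominators are increased by 1 because \<open>m\<close> and \<open>C\<close> may vanish.\<close>
  have "\<exists>Q. simple_function M Q \<and> (\<forall>s\<in>space M. Q s \<in> Lp_space D p) \<and>
      (\<integral>\<^sup>+s. ennreal (Lp_dist D p (K s (r s)) (Q s)) \<partial>M) \<le> ennreal ((1 / 2) ^ i)" for i
  proof -
    define m where "m = measure M (space M)"
    define e where "e = (1 / 2) ^ Suc i / (m + 1)"
    define d where "d = (1 / 2) ^ Suc i / (C + 1)"
    have m: "0 \<le> m" "emeasure M (space M) = ennreal m"
      by (auto simp: m_def emeasure_eq_measure)
    have e: "0 < e" "e * m \<le> (1 / 2) ^ Suc i"
      using m(1) by (auto simp: e_def divide_simps)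
    have d: "0 < d" "C * d \<le> (1 / 2) ^ Suc i"
      using C(1) by (auto simp: d_def divide_simps)
    have "\<forall>\<^sub>F j in sequentially. (\<integral>\<^sup>+s. ennreal (Lp_dist D p (r s) (S j s)) \<partial>M) < ennreal d"
      using S(2) d(1) by (intro order_tendstoD(2)) auto
    then obtain j where j: "(\<integral>\<^sup>+s. ennreal (Lp_dist D p (r s) (S j s)) \<partial>M) < ennreal d"
      by (auto simp: eventually_sequentially)
    obtain h where [measurable]: "h \<in> borel_measurable M"
      and h: "AE s in M. h s = ennreal (Lp_dist D p (r s) (S j s))"
      by (rule Lp_strongly_measurable_dist[OF p rm S'(1,2)[where i=j]]) (assumption, rule that)
    obtain Q where Q: "simple_function M Q" "\<And>s. s \<in> space M \<Longrightarrow> Q s \<in> Lp_space D p"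
      "\<And>s. s \<in> space M \<Longrightarrow> Lp_dist D p (K s (S j s)) (Q s) \<le> e"
      using operator_simple_approx[OF p N K cont e(1) S'(1,2)[where i=j]] by blast
    have "(\<integral>\<^sup>+s. ennreal (Lp_dist D p (K s (r s)) (Q s)) \<partial>M) \<le> (\<integral>\<^sup>+s. ennreal C * h s + ennreal e \<partial>M)"
    proof (rule nn_integral_mono_AE)
      show "AE s in M. ennreal (Lp_dist D p (K s (r s)) (Q s)) \<le> ennreal C * h s + ennreal e"
        using h AE_space
      proof eventually_elim
        case (elim s)
        show ?case
          using dist[OF elim(2) S'(2)[OF elim(2)] Q(2)[OF elim(2)] Q(3)[OF elim(2)]] C(1) e(1)
          by (simp add: elim(1) ennreal_mult'[symmetric] ennreal_plus[symmetric] ennreal_leI del: ennreal_plus)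
      qed
    qed
    also have "\<dots> = ennreal C * (\<integral>\<^sup>+s. h s \<partial>M) + ennreal e * ennreal m"
      by (subst nn_integral_add) (auto simp: nn_integral_cmult m)
    also have "(\<integral>\<^sup>+s. h s \<partial>M) = (\<integral>\<^sup>+s. ennreal (Lp_dist D p (r s) (S j s)) \<partial>M)"
      by (rule nn_integral_cong_AE[OF h])
    also have "ennreal C * \<dots> + ennreal e * ennreal m \<le> ennreal C * ennreal d + ennreal e * ennreal m"
      using j by (intro add_mono mult_left_mono) auto
    also have "\<dots> = ennreal (C * d + e * m)"
      using C(1) d(1) e(1) m(1) by (simp add: ennreal_mult'[symmetric] ennreal_plus[symmetric] del: ennreal_plus)
    also have "\<dots> \<le> ennreal ((1 / 2) ^ i)"
      using d(2) e(2) by (intro ennreal_leI) simp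
    finally show ?thesis
      using Q by blast
  qed
  then obtain U where U: "\<And>i. simple_function M (U i)" "\<And>i s. s \<in> space M \<Longrightarrow> U i s \<in> Lp_space D p"
    "\<And>i. (\<integral>\<^sup>+s. ennreal (Lp_dist D p (K s (r s)) (U i s)) \<partial>M) \<le> ennreal ((1 / 2) ^ i)"
    by metis
  show thesis
    by (rule has_Lp_integralI_fast[OF p sm U]) (assumption | rule that)+
qed

lemma Lp_pairing_operator_integral:
  fixes M :: "real measure"
  assumes fin: "finite_measure M" and p: "1 < p" and N: "sets M = sets (restrict_space borel {0..t})"
    and K: "\<And>s. s \<in> {0..t} \<Longrightarrow> Lp_positive_operator D p (K s)"
    and cont: "Lp_strongly_continuous_on D p {0..t} K"
    and r: "has_Lp_integral D p M r w" "\<And>s. s \<in> {0..t} \<Longrightarrow> r s \<in> Lp_cone D p"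
    and g: "g \<in> Lp_cone D (conj_exp p)"
  shows "ennreal (Lp_pairing D g (Lp_integral D p M (\<lambda>s. K s (r s))))
    = (\<integral>\<^sup>+s. ennreal (Lp_pairing D g (K s (r s))) \<partial>M)"
proof (rule finite_measure.Lp_pairing_has_Lp_integral[OF fin p])
  have sp: "space M = {0..t}"
    using sets_eq_imp_space_eq[OF N] by (simp add: space_restrict_space)
  have p1: "1 \<le> p"
    using p by simp
  obtain v where "has_Lp_integral D p M (\<lambda>s. K s (r s)) v"
    by (rule operator_has_Lp_integral[OF fin p1 N K cont r(1)]) (assumption, rule that)
  then show "has_Lp_integral D p M (\<lambda>s. K s (r s)) (Lp_integral D p M (\<lambda>s. K s (r s)))"
    unfolding Lp_integral_def by (rule someI[of "has_Lp_integral D p M (\<lambda>s. K s (r s))"])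
  show "g \<in> Lp_space D (conj_exp p)"
    using g by (simp add: Lp_cone_def)
  show "0 \<le> Lp_pairing D g (K s (r s))" if "s \<in> space M" for s
    using that sp Lp_pairing_nonneg[OF g Lp_positive_operatorD(4)[OF K r(2)]] by auto
qed

section \<open>Joint measurability\<close>

lemma space_Lp_borel: "space (Lp_borel M p) = Lp_space M p"
  unfolding Lp_borel_def by (intro space_measure_of) (auto simp: Lp_open_def)

text \<open>The pairing with \<open>v\<close> is continuous in \<open>g\<close> by Hoelder's inequality, so its strict superlevel sets
  are among the generators of the \<open>\<sigma>\<close>-algebra.\<close>

lemma Lp_pairing_measurable:
  assumes p: "1 < p" and v: "v \<in> Lp_space M p"
  shows "(\<lambda>g. Lp_pairing M g v) \<in> borel_measurable (Lp_borel M (conj_exp p))"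
  unfolding borel_measurable_iff_greater
proof
  fix c
  let ?U = "{g \<in> space (Lp_borel M (conj_exp p)). c < Lp_pairing M g v}"
  have "Lp_open M (conj_exp p) ?U"
    unfolding Lp_open_def space_Lp_borel
  proof (intro conjI ballI)
    fix u assume u: "u \<in> {g \<in> Lp_space M (conj_exp p). c < Lp_pairing M g v}"
    define e where "e = (Lp_pairing M u v - c) / (Lp_norm M p v + 1)"
    have n: "0 < Lp_norm M p v + 1"
      by (simp add: add_nonneg_pos)
    have e: "0 < e" "e * (Lp_norm M p v + 1) = Lp_pairing M u v - c"
      using u n by (auto simp: e_def)
    show "\<exists>e>0. \<forall>w\<in>Lp_space M (conj_exp p). Lp_dist M (conj_exp p) w u < e \<longrightarrow>
        w \<in> {g \<in> Lp_space M (conj_exp p). c < Lp_pairing M g v}"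
    proof (intro exI[of _ e] conjI ballI impI)
      fix w assume w: "w \<in> Lp_space M (conj_exp p)" and d: "Lp_dist M (conj_exp p) w u < e"
      have q: "1 \<le> conj_exp p"
        using conj_exp(1)[OF p] by simp
      have "\<bar>Lp_pairing M w v - Lp_pairing M u v\<bar> \<le> Lp_dist M (conj_exp p) w u * Lp_norm M p v"
        using Lp_holder(2)[OF p Lp_space_diff[OF q w, of u] v] u
        by (simp add: Lp_pairing_diff_left[OF p w _ v] Lp_dist_def)
      also have "\<dots> \<le> e * Lp_norm M p v"
        using d by (intro mult_right_mono) auto
      also have "\<dots> < Lp_pairing M u v - c"
        using e by (simp add: distrib_left)
      finally show "w \<in> {g \<in> Lp_space M (conj_exp p). c < Lp_pairing M g v}"
        using w by auto
    qed (use e in auto)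
  qed auto
  then show "?U \<in> sets (Lp_borel M (conj_exp p))"
    unfolding Lp_borel_def by (subst sets_measure_of) (auto simp: Lp_open_def)
qed

text \<open>After rounding both times of the operator to the grid, \<open>K y\<close> takes countably many values \<open>v\<close>, and
  for each of them \<open>\<langle>g\<^sub>t, v\<rangle>\<close> is measurable in \<open>t\<close>.  Joint strong continuity removes the rounding.\<close>

lemma operator_pairing_jointly_measurable:
  fixes A :: "real set"
  assumes p: "1 < p" and A: "A \<subseteq> {0..}" "\<And>t s. t \<in> A \<Longrightarrow> 0 \<le> s \<Longrightarrow> s \<le> t \<Longrightarrow> s \<in> A"
    and Q: "sets Q = sets (restrict_space borel A)" and V: "sets V = sets (restrict_space borel A)"
    and g: "g \<in> measurable Q (Lp_borel M (conj_exp p))"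
    and K: "\<And>t s. t \<in> A \<Longrightarrow> s \<in> A \<Longrightarrow> Lp_positive_operator M p (K t s)"
    and cont: "Lp_strongly_continuous_on M p (A \<times> A) (\<lambda>(t, s). K t s)"
    and y: "y \<in> Lp_space M p"
  shows "(\<lambda>(t, s). Lp_pairing M (g t) (K t s y)) \<in> borel_measurable (Q \<Otimes>\<^sub>M V)"
proof (rule borel_measurable_LIMSEQ_real)
  have spQ: "space Q = A" and spV: "space V = A"
    using sets_eq_imp_space_eq[OF Q] sets_eq_imp_space_eq[OF V] by (auto simp: space_restrict_space)
  have dy: "dyadic k t \<in> A" if "t \<in> A" for k t
    using A(2)[OF that, of "dyadic k t"] A(1) that dyadic_le dyadic_nonneg by auto
  have gsp: "g t \<in> Lp_space M (conj_exp p)" if "t \<in> A" for t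
    using measurable_space[OF g, of t] that by (simp add: spQ space_Lp_borel)
  show "(\<lambda>k. case z of (t, s) \<Rightarrow> Lp_pairing M (g t) (K (dyadic k t) (dyadic k s) y))
      \<longlonglongrightarrow> (case z of (t, s) \<Rightarrow> Lp_pairing M (g t) (K t s y))" if "z \<in> space (Q \<Otimes>\<^sub>M V)" for z
  proof -
    obtain t s where z: "z = (t, s)" "t \<in> A" "s \<in> A"
      using \<open>z \<in> space (Q \<Otimes>\<^sub>M V)\<close> by (auto simp: space_pair_measure spQ spV)
    have "(\<lambda>k. Lp_dist M p (K (dyadic k t) (dyadic k s) y) (K t s y)) \<longlonglongrightarrow> 0"
      using Lp_strongly_continuous_onD[OF cont y, of "(t, s)" "\<lambda>k. (dyadic k t, dyadic k s)"] z dy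
      by (auto intro: tendsto_Pair[OF dyadic_tendsto dyadic_tendsto])
    then show ?thesis
      unfolding z(1) prod.case
      by (rule tendsto_Lp_pairing[OF p gsp[OF z(2)], rotated 2])
         (use z dy y in \<open>auto intro: Lp_positive_operatorD(1)[OF K]\<close>)
  qed
  fix k
  let ?i = "\<lambda>t::real. \<lfloor>t * 2 ^ k\<rfloor>"
  define F where "F ij z = (if of_int (fst ij) / 2 ^ k \<in> A \<and> of_int (snd ij) / 2 ^ k \<in> A
    then Lp_pairing M (g (fst z)) (K (of_int (fst ij) / 2 ^ k) (of_int (snd ij) / 2 ^ k) y) else 0)"
    for ij :: "int \<times> int" and z :: "real \<times> real"
  have "(\<lambda>z. F (?i (fst z), ?i (snd z)) z) \<in> borel_measurable (Q \<Otimes>\<^sub>M V)"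
  proof (rule measurable_compose_countable[where f="\<lambda>i z. F i z"])
    fix ij :: "int \<times> int"
    have "(\<lambda>t. Lp_pairing M (g t) v) \<in> borel_measurable Q" if "v \<in> Lp_space M p" for v
      using measurable_compose[OF g Lp_pairing_measurable[OF p that]] .
    then have "(\<lambda>z. Lp_pairing M (g (fst z)) v) \<in> borel_measurable (Q \<Otimes>\<^sub>M V)" if "v \<in> Lp_space M p" for v
      using measurable_compose[OF measurable_fst] that by blast
    then show "F ij \<in> borel_measurable (Q \<Otimes>\<^sub>M V)"
      using Lp_positive_operatorD(1)[OF K y]
      by (cases "of_int (fst ij) / 2 ^ k \<in> A \<and> of_int (snd ij) / 2 ^ k \<in> A") (auto simp: F_def[abs_def])
  next
    have "id \<in> borel_measurable Q" "id \<in> borel_measurable V"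
      by (simp_all add: measurable_cong_sets[OF Q refl] measurable_cong_sets[OF V refl] measurable_restrict_space1)
    from measurable_compose[OF measurable_fst this(1), of V] measurable_compose[OF measurable_snd this(2), of Q]
    have [measurable]: "fst \<in> borel_measurable (Q \<Otimes>\<^sub>M V)" "snd \<in> borel_measurable (Q \<Otimes>\<^sub>M V)"
      by simp_all
    show "(\<lambda>z. (?i (fst z), ?i (snd z))) \<in> measurable (Q \<Otimes>\<^sub>M V) (count_space UNIV)"
      by measurable
  qed
  moreover have "F (?i (fst z), ?i (snd z)) z = (case z of (t, s) \<Rightarrow> Lp_pairing M (g t) (K (dyadic k t) (dyadic k s) y))"
    if "z \<in> space (Q \<Otimes>\<^sub>M V)" for z
  proof -
    have "dyadic k (fst z) \<in> A" "dyadic k (snd z) \<in> A"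
      using that by (auto simp: space_pair_measure spQ spV dy)
    then show ?thesis
      by (simp add: F_def dyadic_def case_prod_beta)
  qed
  ultimately show "(\<lambda>z. case z of (t, s) \<Rightarrow> Lp_pairing M (g t) (K (dyadic k t) (dyadic k s) y)) \<in> borel_measurable (Q \<Otimes>\<^sub>M V)"
    by (subst measurable_cong[symmetric])
qed

text \<open>The vector \<open>y\<close> may be replaced by the values of a simple function of \<open>s\<close>, hence by their limit \<open>r s\<close>
  outside a null set \<open>Z\<close> that contains every \<open>s\<close> at which the simple functions do not converge to it.\<close>

lemma operator_density_pairing_jointly_measurable:
  fixes A :: "real set"
  assumes p: "1 < p" and A: "A \<subseteq> {0..}" "\<And>t s. t \<in> A \<Longrightarrow> 0 \<le> s \<Longrightarrow> s \<le> t \<Longrightarrow> s \<in> A"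
    and Q: "sets Q = sets (restrict_space borel A)" and V: "sets V = sets (restrict_space borel A)"
    and g: "g \<in> measurable Q (Lp_borel M (conj_exp p))"
    and K: "\<And>t s. t \<in> A \<Longrightarrow> s \<in> A \<Longrightarrow> Lp_positive_operator M p (K t s)"
    and cont: "Lp_strongly_continuous_on M p (A \<times> A) (\<lambda>(t, s). K t s)"
    and r: "Lp_strongly_measurable M p V r"
  obtains Z where "Z \<in> null_sets V"
    "(\<lambda>(t, s). if s \<in> Z then 0 else Lp_pairing M (g t) (K t s (r s))) \<in> borel_measurable (Q \<Otimes>\<^sub>M V)"
proof -
  have p1: "1 \<le> p"
    using p by simp
  have spQ: "space Q = A" and spV: "space V = A"
    using sets_eq_imp_space_eq[OF Q] sets_eq_imp_space_eq[OF V] by (auto simp: space_restrict_space)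
  have gsp: "g t \<in> Lp_space M (conj_exp p)" if "t \<in> A" for t
    using measurable_space[OF g, of t] that by (simp add: spQ space_Lp_borel)
  obtain R where R: "\<And>i. simple_function V (R i)" "\<And>i s. s \<in> A \<Longrightarrow> R i s \<in> Lp_space M p"
    "AE s in V. (\<lambda>i::nat. Lp_dist M p (r s) (R i s)) \<longlonglongrightarrow> 0"
    and r': "\<And>s. s \<in> A \<Longrightarrow> r s \<in> Lp_space M p"
    using r unfolding Lp_strongly_measurable_def spV by auto
  obtain Z where Z: "{s \<in> space V. \<not> (\<lambda>i. Lp_dist M p (r s) (R i s)) \<longlonglongrightarrow> 0} \<subseteq> Z" "Z \<in> null_sets V"
    using R(3) by (auto simp: eventually_ae_filter)
  have [measurable]: "Z \<in> sets V"
    using Z(2) by auto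
  have "(\<lambda>(t, s). if s \<in> Z then 0 else Lp_pairing M (g t) (K t s (r s))) \<in> borel_measurable (Q \<Otimes>\<^sub>M V)"
  proof (rule borel_measurable_LIMSEQ_real)
    fix i
    have "(\<lambda>z. case z of (t, s) \<Rightarrow> Lp_pairing M (g t) (K t s (R i (snd z)))) \<in> borel_measurable (Q \<Otimes>\<^sub>M V)"
    proof (rule measurable_compose_countable'[where I="R i ` space V" and f="\<lambda>y (t, s). Lp_pairing M (g t) (K t s y)"])
      show "(\<lambda>(t, s). Lp_pairing M (g t) (K t s y)) \<in> borel_measurable (Q \<Otimes>\<^sub>M V)" if "y \<in> R i ` space V" for y
        using that R(2) spV by (intro operator_pairing_jointly_measurable[OF p A Q V g K cont]) auto
      have "R i \<in> measurable V (count_space (R i ` space V))"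
        by (rule measurable_count_space_extend[OF subset_UNIV])
           (use measurable_simple_function[OF R(1)] in auto)
      then show "(\<lambda>z. R i (snd z)) \<in> measurable (Q \<Otimes>\<^sub>M V) (count_space (R i ` space V))"
        by (rule measurable_compose[OF measurable_snd])
      show "countable (R i ` space V)"
        by (intro countable_finite simple_functionD(1)[OF R(1)])
    qed
    then have [measurable]: "(\<lambda>z. Lp_pairing M (g (fst z)) (K (fst z) (snd z) (R i (snd z)))) \<in> borel_measurable (Q \<Otimes>\<^sub>M V)"
      by (simp add: case_prod_beta)
    have "(\<lambda>z. if snd z \<in> Z then 0 else Lp_pairing M (g (fst z)) (K (fst z) (snd z) (R i (snd z)))) \<in> borel_measurable (Q \<Otimes>\<^sub>M V)"
      by measurable
    then show "(\<lambda>(t, s). if s \<in> Z then 0 else Lp_pairing M (g t) (K t s (R i s))) \<in> borel_measurable (Q \<Otimes>\<^sub>M V)"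
      by (simp add: case_prod_beta')
  next
    fix z assume "z \<in> space (Q \<Otimes>\<^sub>M V)"
    then obtain t s where z: "z = (t, s)" "t \<in> A" "s \<in> A"
      by (auto simp: space_pair_measure spQ spV)
    have "(\<lambda>i. Lp_pairing M (g t) (K t s (R i s))) \<longlonglongrightarrow> Lp_pairing M (g t) (K t s (r s))" if "s \<notin> Z"
    proof (rule tendsto_Lp_pairing[OF p gsp[OF z(2)]])
      obtain C where C: "\<And>v. v \<in> Lp_space M p \<Longrightarrow> Lp_norm M p (K t s v) \<le> C * Lp_norm M p v"
        using Lp_positive_operatorD(3)[OF K[OF z(2,3)]] by blast
      have "(\<lambda>i. Lp_dist M p (r s) (R i s)) \<longlonglongrightarrow> 0"
        using that Z(1) z(3) spV by auto
      then have l: "(\<lambda>i. C * Lp_dist M p (r s) (R i s)) \<longlonglongrightarrow> 0"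
        using tendsto_mult_left[of _ 0 _ C] by simp
      show "(\<lambda>i. Lp_dist M p (K t s (R i s)) (K t s (r s))) \<longlonglongrightarrow> 0"
      proof (rule Lim_null_comparison[OF always_eventually l], intro allI)
        fix i
        have "Lp_dist M p (K t s (r s)) (K t s (R i s)) \<le> C * Lp_dist M p (r s) (R i s)"
          unfolding Lp_dist_def[of M p "r s"]
          by (subst Lp_positive_operator_dist[OF p1 K[OF z(2,3)] r'[OF z(3)] R(2)[OF z(3)]])
             (intro C Lp_space_diff p1 r' R(2) z)
        then show "norm (Lp_dist M p (K t s (R i s)) (K t s (r s))) \<le> C * Lp_dist M p (r s) (R i s)"
          by (simp add: Lp_dist_commute)
      qed
    qed (use z R(2) r' in \<open>auto intro: Lp_positive_operatorD(1)[OF K]\<close>)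
    then show "(\<lambda>i. case z of (t, s) \<Rightarrow> if s \<in> Z then 0 else Lp_pairing M (g t) (K t s (R i s)))
        \<longlonglongrightarrow> (case z of (t, s) \<Rightarrow> if s \<in> Z then 0 else Lp_pairing M (g t) (K t s (r s)))"
      by (simp add: z(1))
  qed
  then show thesis
    using Z(2) that by blast
qed

section \<open>Pairing with a pointwise integral\<close>

text \<open>On \<open>{v > 1/n}\<close> one has \<open>v \<le> n\<^sup>p\<^sup>-\<^sup>1 v\<^sup>p\<close>, so \<open>v dM\<close> is finite there; \<open>{v \<le> 0}\<close> has measure \<open>0\<close>
  because \<open>ennreal\<close> truncates negative values.\<close>

lemma sigma_finite_density_Lp:
  assumes p: "1 \<le> p" and v: "v \<in> Lp_space M p"
  shows "sigma_finite_measure (density M (\<lambda>x. ennreal (v x)))"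
proof
  let ?D = "density M (\<lambda>x. ennreal (v x))"
  note [measurable] = Lp_spaceD(1)[OF v]
  let ?A = "\<lambda>n::nat. {x \<in> space M. 1 / real (Suc n) < v x}" and ?Z = "{x \<in> space M. v x \<le> 0}"
  have fin: "emeasure ?D (?A n) \<noteq> \<infinity>" for n
  proof -
    have "emeasure ?D (?A n) = (\<integral>\<^sup>+x. ennreal (v x) * indicator (?A n) x \<partial>M)"
      by (rule emeasure_density) auto
    also have "\<dots> \<le> (\<integral>\<^sup>+x. ennreal (real (Suc n) powr (p - 1) * \<bar>v x\<bar> powr p) \<partial>M)"
    proof (rule nn_integral_mono)
      fix x
      have "v x \<le> real (Suc n) powr (p - 1) * \<bar>v x\<bar> powr p" if "1 / real (Suc n) < v x"
      proof -
        have pos: "0 < v x"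
          using that by (rule less_trans[rotated]) simp
        have "1 \<le> real (Suc n) * v x"
          using that by (simp add: divide_less_eq mult.commute)
        then have "1 \<le> (real (Suc n) * v x) powr (p - 1)"
          using p by (intro ge_one_powr_ge_zero) auto
        also have "\<dots> = real (Suc n) powr (p - 1) * v x powr (p - 1)"
          using pos by (subst powr_mult) auto
        finally have "v x * 1 \<le> v x * (real (Suc n) powr (p - 1) * v x powr (p - 1))"
          using pos by (intro mult_left_mono) auto
        then show ?thesis
          using pos by (simp add: powr_diff)
      qed
      then show "ennreal (v x) * indicator (?A n) x \<le> ennreal (real (Suc n) powr (p - 1) * \<bar>v x\<bar> powr p)"
        by (auto split: split_indicator intro: ennreal_leI)
    qed
    also have "\<dots> < \<infinity>"
    proof -
      have "integrable M (\<lambda>x. real (Suc n) powr (p - 1) * \<bar>v x\<bar> powr p)"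
        using Lp_spaceD(2)[OF v] by simp
      then show ?thesis
        by (subst nn_integral_eq_integral) auto
    qed
    finally show ?thesis
      by simp
  qed
  have "emeasure ?D ?Z = (\<integral>\<^sup>+x. ennreal (v x) * indicator ?Z x \<partial>M)"
    by (rule emeasure_density) auto
  also have "\<dots> = (\<integral>\<^sup>+x. 0 \<partial>M)"
    by (intro nn_integral_cong) (auto split: split_indicator simp: ennreal_neg)
  finally have z: "emeasure ?D ?Z = 0"
    by simp
  have cover: "\<Union> (insert ?Z (range ?A)) = space ?D"
  proof -
    have "x \<in> ?Z \<or> (\<exists>n. x \<in> ?A n)" if "x \<in> space M" for x
    proof (cases "v x \<le> 0")
      case False
      then obtain n where "1 / real (Suc n) < v x"
        using nat_approx_posE[of "v x"] by auto
      then show ?thesis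
        using that by blast
    qed (use that in simp)
    then show ?thesis
      by auto
  qed
  show "\<exists>A. countable A \<and> A \<subseteq> sets ?D \<and> \<Union> A = space ?D \<and> (\<forall>a\<in>A. emeasure ?D a \<noteq> \<infinity>)"
  proof (intro exI[of _ "insert ?Z (range ?A)"] conjI cover ballI)
    show "emeasure ?D a \<noteq> \<infinity>" if "a \<in> insert ?Z (range ?A)" for a
      using that fin z by (elim insertE imageE) simp_all
  qed auto
qed

text \<open>Tonelli's theorem for the jointly measurable version \<open>\<phi>\<close> of \<open>G\<close>.  The measure \<open>M\<close> is arbitrary; the
  exchange is legitimate because the factor \<open>v\<close> can be absorbed into \<open>M\<close>, with a \<open>\<sigma>\<close>-finite result.\<close>

lemma Lp_pairing_ext_pointwise_integral:
  assumes p: "1 < p" and q: "sigma_finite_measure q" and B: "B \<in> sets q"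
    and h: "pointwise_integral M q B G h" and G: "\<And>t. t \<in> B \<Longrightarrow> G t \<in> Lp_cone M (conj_exp p)"
    and v: "v \<in> Lp_cone M p"
  shows "Lp_pairing_ext M h v = (\<integral>\<^sup>+t. ennreal (Lp_pairing M (G t) v) * indicator B t \<partial>q)"
proof -
  note [measurable] = B
  have v': "v \<in> Lp_space M p" "AE x in M. 0 \<le> v x"
    using v by (auto simp: Lp_cone_def)
  note [measurable] = Lp_spaceD(1)[OF v'(1)]
  let ?D = "density M (\<lambda>x. ennreal (v x))"
  interpret D: sigma_finite_measure ?D
    using sigma_finite_density_Lp[OF _ v'(1)] p by simp
  interpret q: sigma_finite_measure q by (rule q)
  interpret qD: pair_sigma_finite q ?D ..
  obtain \<phi> where [measurable]: "\<phi> \<in> borel_measurable (q \<Otimes>\<^sub>M M)"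
    and \<phi>: "AE t in q. t \<in> B \<longrightarrow> (AE x in M. \<phi> (t, x) = ennreal (G t x))"
    and h: "\<And>x. x \<in> space M \<Longrightarrow> h x = (\<integral>\<^sup>+t. \<phi> (t, x) * indicator B t \<partial>q)"
    using h unfolding pointwise_integral_def by auto
  have [measurable]: "(\<lambda>x. \<integral>\<^sup>+t. \<phi> (t, x) * indicator B t \<partial>q) \<in> borel_measurable M"
    by (intro q.borel_measurable_nn_integral) measurable
  have "(\<lambda>(t, x). \<phi> (t, x) * indicator B t) \<in> borel_measurable (q \<Otimes>\<^sub>M M)"
    by measurable
  then have m: "(\<lambda>(t, x). \<phi> (t, x) * indicator B t) \<in> borel_measurable (q \<Otimes>\<^sub>M ?D)"
    by (subst measurable_cong_sets[OF sets_pair_measure_cong[OF refl sets_density] refl])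
  have "Lp_pairing_ext M h v = (\<integral>\<^sup>+x. ennreal (v x) * (\<integral>\<^sup>+t. \<phi> (t, x) * indicator B t \<partial>q) \<partial>M)"
    unfolding Lp_pairing_ext_def by (intro nn_integral_cong) (simp add: h mult.commute)
  also have "\<dots> = (\<integral>\<^sup>+x. (\<integral>\<^sup>+t. \<phi> (t, x) * indicator B t \<partial>q) \<partial>?D)"
    by (rule nn_integral_density[symmetric]) auto
  also have "\<dots> = (\<integral>\<^sup>+t. (\<integral>\<^sup>+x. \<phi> (t, x) * indicator B t \<partial>?D) \<partial>q)"
    by (rule qD.Fubini'[OF m])
  also have "\<dots> = (\<integral>\<^sup>+t. ennreal (Lp_pairing M (G t) v) * indicator B t \<partial>q)"
  proof (rule nn_integral_cong_AE)
    show "AE t in q. (\<integral>\<^sup>+x. \<phi> (t, x) * indicator B t \<partial>?D) = ennreal (Lp_pairing M (G t) v) * indicator B t"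
      using \<phi> AE_space
    proof eventually_elim
      case (elim t)
      show ?case
      proof (cases "t \<in> B")
        case True
        have G': "G t \<in> Lp_space M (conj_exp p)" "AE x in M. 0 \<le> G t x"
          using G[OF True] by (auto simp: Lp_cone_def)
        have [measurable]: "(\<lambda>x. \<phi> (t, x)) \<in> borel_measurable M"
          using elim(2) by measurable
        have "(\<integral>\<^sup>+x. \<phi> (t, x) * indicator B t \<partial>?D) = (\<integral>\<^sup>+x. ennreal (v x) * \<phi> (t, x) \<partial>M)"
          using True by (subst nn_integral_density) auto
        also have "\<dots> = (\<integral>\<^sup>+x. ennreal (G t x * v x) \<partial>M)"
        proof (rule nn_integral_cong_AE)
          have "AE x in M. \<phi> (t, x) = ennreal (G t x)"
            using elim(1) True by simp
          then show "AE x in M. ennreal (v x) * \<phi> (t, x) = ennreal (G t x * v x)"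
            using v'(2) G'(2) by eventually_elim (simp add: ennreal_mult mult.commute)
        qed
        also have "\<dots> = ennreal (Lp_pairing M (G t) v)"
          unfolding Lp_pairing_def using v'(2) G'(2)
          by (intro nn_integral_eq_integral Lp_holder(1)[OF p G'(1) v'(1)]) (auto elim: eventually_elim2)
        finally show ?thesis
          using True by simp
      qed simp
    qed
  qed
  finally show ?thesis .
qed

lemma Lp_adjoint_cone:
  assumes p: "1 < p" and K: "Lp_positive_operator M p K" and adj: "Lp_adjoint M p K K'"
    and g: "g \<in> Lp_cone M (conj_exp p)"
  shows "K' g \<in> Lp_cone M (conj_exp p)"
proof (rule Lp_cone_if_pairing_nonneg[OF p])
  have g': "g \<in> Lp_space M (conj_exp p)"
    using g by (simp add: Lp_cone_def)
  then show "K' g \<in> Lp_space M (conj_exp p)"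
    using adj by (simp add: Lp_adjoint_def)
  fix v assume v: "v \<in> Lp_cone M p"
  then have "Lp_pairing M (K' g) v = Lp_pairing M g (K v)"
    using adj g' by (simp add: Lp_adjoint_def Lp_cone_def)
  also have "0 \<le> \<dots>"
    using Lp_pairing_nonneg[OF g Lp_positive_operatorD(4)[OF K v]] .
  finally show "0 \<le> Lp_pairing M (K' g) v" .
qed

section \<open>The variation measure\<close>

lemma sets_variation_measure: "sets (variation_measure M p T n) = sets (time_borel T)"
proof -
  have sp: "space (time_borel T) = time_set T"
    by (simp add: time_borel_def space_restrict_space)
  show ?thesis
    unfolding variation_measure_def
    using sets.sets_measure_of_eq[of "time_borel T"] by (simp add: sp)
qed

text \<open>An inequality is all that holds for free: \<open>measure_of\<close> yields the zero measure if the total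
  variation is not countably additive, and the value \<open>0\<close> on sets that are not measurable.\<close>

lemma emeasure_variation_measure_le:
  "emeasure (variation_measure M p T n) A \<le> total_variation M p T (path_measure M p T n) A"
  by (simp add: variation_measure_def emeasure_measure_of_conv)

lemma Icc_in_time_borel:
  assumes "t \<in> time_set T"
  shows "{0..t} \<subseteq> time_set T" "{0..t} \<in> sets (time_borel T)" "{0..t} \<in> bounded_borel T"
proof -
  show s: "{0..t} \<subseteq> time_set T"
  proof
    fix s assume "s \<in> {0..t}"
    then have "0 \<le> s" "ereal s \<le> ereal t"
      by auto
    moreover have "ereal t \<le> T"
      using assms by (simp add: time_set_def)
    ultimately show "s \<in> time_set T"
      unfolding time_set_def using order_trans by blast
  qed
  have "{0..t} = {0..t} \<inter> time_set T"
    using s by blast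
  then show "{0..t} \<in> sets (time_borel T)"
    unfolding time_borel_def sets_restrict_space by (auto simp: image_iff intro!: bexI[of _ "{0..t}"])
  show "{0..t} \<in> bounded_borel T"
    using s by (simp add: bounded_borel_def)
qed

lemma sigma_finite_variation_measure:
  assumes T: "0 < T" and fv: "finite_variation M p T n"
  shows "sigma_finite_measure (variation_measure M p T n)"
proof
  let ?V = "variation_measure M p T n"
  have sp: "space ?V = time_set T"
    using sets_eq_imp_space_eq[OF sets_variation_measure] by (simp add: time_borel_def space_restrict_space)
  \<comment> \<open>For finite \<open>T\<close> the single interval \<open>[0,T]\<close> covers the time set.\<close>
  define \<tau> where "\<tau> k = (if T = \<infinity> then real k else real_of_ereal T)" for k :: nat
  have \<tau>: "\<tau> k \<in> time_set T" for k
    using T by (cases T) (auto simp: \<tau>_def time_set_def)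
  have "\<exists>k. s \<in> {0..\<tau> k}" if "s \<in> time_set T" for s
    using that T real_arch_simple[of s] by (cases T) (auto simp: \<tau>_def time_set_def)
  then have "(\<Union>k. {0..\<tau> k}) = space ?V"
    unfolding sp using Icc_in_time_borel(1)[OF \<tau>] by blast
  moreover have "emeasure ?V {0..\<tau> k} \<noteq> \<infinity>" for k
    using emeasure_variation_measure_le[of M p T n "{0..\<tau> k}"] fv \<tau>[of k]
    unfolding finite_variation_def by (metis infinity_ennreal_def not_less top_greatest)
  ultimately show "\<exists>A. countable A \<and> A \<subseteq> sets ?V \<and> \<Union> A = space ?V \<and> (\<forall>a\<in>A. emeasure ?V a \<noteq> \<infinity>)"
    using Icc_in_time_borel(2)[OF \<tau>] by (intro exI[of _ "range (\<lambda>k. {0..\<tau> k})"]) (auto simp: sets_variation_measure)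
qed

lemma ennreal_pairing_operator_path_integral:
  assumes p: "1 < p" and t: "t \<in> time_set T" and fv: "finite_variation M p T n"
    and r: "variation_density M p T n r"
    and K: "\<And>s. s \<in> time_set T \<Longrightarrow> Lp_positive_operator M p (K s)"
    and cont: "Lp_strongly_continuous_on M p (time_set T) K"
    and g: "g \<in> Lp_cone M (conj_exp p)"
  shows "ennreal (Lp_pairing M g (operator_path_integral M p T n r t K))
    = (\<integral>\<^sup>+s. ennreal (Lp_pairing M g (K s (r s))) * indicator {0..t} s \<partial>variation_measure M p T n)"
proof -
  let ?V = "variation_measure M p T n"
  let ?N = "restrict_space ?V {0..t}"
  note I = Icc_in_time_borel[OF t]
  have sp: "space ?V = time_set T"
    using sets_eq_imp_space_eq[OF sets_variation_measure] by (simp add: time_borel_def space_restrict_space)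
  have I': "{0..t} \<inter> space ?V \<in> sets ?V"
    using I by (simp add: sp sets_variation_measure Int_absorb2)
  have "emeasure ?V {0..t} < \<infinity>"
    using emeasure_variation_measure_le[of M p T n "{0..t}"] fv t
    unfolding finite_variation_def by (auto intro: le_less_trans)
  then have fin: "finite_measure ?N"
    using I I' by (intro finite_measureI) (simp add: space_restrict_space emeasure_restrict_space sp Int_absorb2)
  have sN: "sets ?N = sets (restrict_space borel {0..t})"
  proof -
    have "sets ?N = sets (restrict_space (time_borel T) {0..t})"
      by (rule sets_restrict_space_cong[OF sets_variation_measure])
    also have "\<dots> = sets (restrict_space borel {0..t})"
      using I(1) unfolding time_borel_def by (subst sets_restrict_restrict_space) (simp add: Int_absorb1)
    finally show ?thesis .
  qed
  have r': "has_Lp_integral M p ?N r (path_measure M p T n {0..t})" "\<And>s. s \<in> {0..t} \<Longrightarrow> r s \<in> Lp_cone M p"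
    using r I unfolding variation_density_def by auto
  have "ennreal (Lp_pairing M g (operator_path_integral M p T n r t K))
      = (\<integral>\<^sup>+s. ennreal (Lp_pairing M g (K s (r s))) \<partial>?N)"
    unfolding operator_path_integral_def
    by (rule Lp_pairing_operator_integral[OF fin p sN _ _ r' g])
       (use K I(1) Lp_strongly_continuous_on_subset[OF cont I(1)] in auto)
  also have "\<dots> = (\<integral>\<^sup>+s. ennreal (Lp_pairing M g (K s (r s))) * indicator {0..t} s \<partial>?V)"
    by (rule nn_integral_restrict_space[OF I'])
  finally show ?thesis .
qed

section \<open>Exchange of the order of integration\<close>

text \<open>The identity for a single path.  The integrand \<open>a\<close> is set to \<open>0\<close> on a null set of \<open>s\<close> to make it
  jointly measurable, which changes neither iterated integral.\<close>

theorem operator_path_integral_duality: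
  assumes p: "1 < p" and T: "0 < T" and q: "finite_measure q" and sq: "sets q = sets (time_borel T)"
    and g: "\<And>t. t \<in> time_set T \<Longrightarrow> g t \<in> Lp_cone M (conj_exp p)"
    and gm: "g \<in> measurable (time_borel T) (Lp_borel M (conj_exp p))"
    and K: "\<And>t s. t \<in> time_set T \<Longrightarrow> s \<in> time_set T \<Longrightarrow> Lp_positive_operator M p (K t s)"
    and cont: "Lp_strongly_continuous_on M p (time_set T \<times> time_set T) (\<lambda>(t, s). K t s)"
    and adj: "\<And>t s. t \<in> time_set T \<Longrightarrow> s \<in> time_set T \<Longrightarrow> Lp_adjoint M p (K t s) (K' t s)"
    and fv: "finite_variation M p T n" and r: "variation_density M p T n r"
    and h: "\<And>s. s \<in> time_set T \<Longrightarrow>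
      pointwise_integral M q (time_set T \<inter> {s..}) (\<lambda>t. K' t s (g t)) (h s)"
  shows "(\<integral>\<^sup>+t. ennreal (Lp_pairing M (g t) (operator_path_integral M p T n r t (K t))) \<partial>q)
    = dual_path_integral M p T n r h"
proof -
  let ?V = "variation_measure M p T n" and ?A = "time_set T"
  have spV: "space ?V = ?A" and spq: "space q = ?A"
    using sets_eq_imp_space_eq[OF sets_variation_measure] sets_eq_imp_space_eq[OF sq]
    by (simp_all add: time_borel_def space_restrict_space)
  interpret q: finite_measure q by (rule q)
  interpret V: sigma_finite_measure ?V
    by (rule sigma_finite_variation_measure[OF T fv])
  interpret qV: pair_sigma_finite q ?V ..
  have A: "?A \<subseteq> {0..}" "\<And>t s. t \<in> ?A \<Longrightarrow> 0 \<le> s \<Longrightarrow> s \<le> t \<Longrightarrow> s \<in> ?A"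
    by (simp add: time_set_def subset_iff) (use Icc_in_time_borel(1) in \<open>meson atLeastAtMost_iff subsetD\<close>)
  have r1: "\<And>s. s \<in> ?A \<Longrightarrow> r s \<in> Lp_cone M p" "Lp_strongly_measurable M p ?V r"
    using r by (auto simp: variation_density_def)
  obtain Z where Z: "Z \<in> null_sets ?V"
    and m: "(\<lambda>(t, s). if s \<in> Z then 0 else Lp_pairing M (g t) (K t s (r s))) \<in> borel_measurable (q \<Otimes>\<^sub>M ?V)"
  proof (rule operator_density_pairing_jointly_measurable[OF p A _ _ _ K cont r1(2)])
    show "sets q = sets (restrict_space borel ?A)" "sets ?V = sets (restrict_space borel ?A)"
      by (simp_all add: sq sets_variation_measure time_borel_def)
    show "g \<in> measurable q (Lp_borel M (conj_exp p))"
      using gm by (subst measurable_cong_sets[OF sq refl])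
  qed auto
  define a where "a t s = ennreal (if s \<in> Z then 0 else Lp_pairing M (g t) (K t s (r s))) * indicator {s..} t"
    for t s
  have am: "(\<lambda>(t, s). a t s) \<in> borel_measurable (q \<Otimes>\<^sub>M ?V)"
  proof -
    have "id \<in> borel_measurable q" "id \<in> borel_measurable ?V"
      by (simp_all add: measurable_cong_sets[OF sq refl] measurable_cong_sets[OF sets_variation_measure refl]
          time_borel_def measurable_restrict_space1)
    from measurable_compose[OF measurable_fst this(1), of ?V] measurable_compose[OF measurable_snd this(2), of q]
    have [measurable]: "fst \<in> borel_measurable (q \<Otimes>\<^sub>M ?V)" "snd \<in> borel_measurable (q \<Otimes>\<^sub>M ?V)"
      by simp_all
    note [measurable] = m[unfolded case_prod_beta']
    have "(\<lambda>z. a (fst z) (snd z)) = (\<lambda>z. ennreal (if snd z \<in> Z then 0 else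
        Lp_pairing M (g (fst z)) (K (fst z) (snd z) (r (snd z)))) * (if snd z \<le> fst z then 1 else 0))"
      by (auto simp: a_def fun_eq_iff indicator_def)
    also have "\<dots> \<in> borel_measurable (q \<Otimes>\<^sub>M ?V)"
      by measurable
    finally show ?thesis
      by (simp add: case_prod_beta')
  qed
  have ae: "AE s in ?V. s \<notin> Z"
    using Z by (rule AE_not_in)
  have "(\<integral>\<^sup>+t. ennreal (Lp_pairing M (g t) (operator_path_integral M p T n r t (K t))) \<partial>q)
      = (\<integral>\<^sup>+t. (\<integral>\<^sup>+s. a t s \<partial>?V) \<partial>q)"
  proof (rule nn_integral_cong)
    fix t assume "t \<in> space q"
    then have t: "t \<in> ?A"
      by (simp add: spq)
    have "ennreal (Lp_pairing M (g t) (operator_path_integral M p T n r t (K t)))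
        = (\<integral>\<^sup>+s. ennreal (Lp_pairing M (g t) (K t s (r s))) * indicator {0..t} s \<partial>?V)"
      by (rule ennreal_pairing_operator_path_integral[OF p t fv r K[OF t]
            Lp_strongly_continuous_on_section[OF cont t] g[OF t]])
    also have "\<dots> = (\<integral>\<^sup>+s. a t s \<partial>?V)"
    proof (rule nn_integral_cong_AE)
      show "AE s in ?V. ennreal (Lp_pairing M (g t) (K t s (r s))) * indicator {0..t} s = a t s"
        using ae AE_space by eventually_elim (use A(1) in \<open>auto simp: a_def spV indicator_def\<close>)
    qed
    finally show "ennreal (Lp_pairing M (g t) (operator_path_integral M p T n r t (K t))) = (\<integral>\<^sup>+s. a t s \<partial>?V)" .
  qed
  also have "\<dots> = (\<integral>\<^sup>+s. (\<integral>\<^sup>+t. a t s \<partial>q) \<partial>?V)"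
    by (rule qV.Fubini'[OF am, symmetric])
  also have "\<dots> = (\<integral>\<^sup>+s. Lp_pairing_ext M (h s) (r s) \<partial>?V)"
  proof (rule nn_integral_cong_AE)
    show "AE s in ?V. (\<integral>\<^sup>+t. a t s \<partial>q) = Lp_pairing_ext M (h s) (r s)"
      using ae AE_space
    proof eventually_elim
      case (elim s)
      then have s: "s \<in> ?A"
        by (simp add: spV)
      have B: "?A \<inter> {s..} \<in> sets q"
        unfolding sq time_borel_def sets_restrict_space by auto
      have "Lp_pairing_ext M (h s) (r s)
          = (\<integral>\<^sup>+t. ennreal (Lp_pairing M (K' t s (g t)) (r s)) * indicator (?A \<inter> {s..}) t \<partial>q)"
        by (rule Lp_pairing_ext_pointwise_integral[OF p q.sigma_finite_measure_axioms B h[OF s] _ r1(1)[OF s]])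
           (use s in \<open>auto intro: Lp_adjoint_cone[OF p K adj g]\<close>)
      also have "\<dots> = (\<integral>\<^sup>+t. a t s \<partial>q)"
      proof (rule nn_integral_cong)
        fix t assume "t \<in> space q"
        then have t: "t \<in> ?A"
          by (simp add: spq)
        have "Lp_pairing M (K' t s (g t)) (r s) = Lp_pairing M (g t) (K t s (r s))"
          using adj[OF t s] g[OF t] r1(1)[OF s] by (simp add: Lp_adjoint_def Lp_cone_def)
        then show "ennreal (Lp_pairing M (K' t s (g t)) (r s)) * indicator (?A \<inter> {s..}) t = a t s"
          using t elim(1) by (simp add: a_def indicator_def)
      qed
      finally show ?case ..
    qed
  qed
  finally show ?thesis
    by (simp add: dual_path_integral_def)
qed

theorem lemma2p3:
  fixes M :: "'d measure" and p :: real and T :: ereal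
    and P :: "'w measure" and F :: "real \<Rightarrow> 'w measure"
    and f :: "real \<Rightarrow> 'w \<Rightarrow> 'd \<Rightarrow> real"
    and \<Theta> \<Theta>' :: "real \<Rightarrow> real \<Rightarrow> ('d \<Rightarrow> real) \<Rightarrow> ('d \<Rightarrow> real)"
    and q :: "real measure"
    and \<nu> \<rho> :: "'w \<Rightarrow> real \<Rightarrow> 'd \<Rightarrow> real"
    and H :: "'w \<Rightarrow> real \<Rightarrow> 'd \<Rightarrow> ennreal"
  assumes "1 < p" and "0 < T"
    and "prob_space P" and "usual_filtration T P F"
    and f_cone: "\<And>t \<omega>. t \<in> time_set T \<Longrightarrow> \<omega> \<in> space P \<Longrightarrow> f t \<omega> \<in> Lp_cone M (conj_exp p)"
    and f_meas: "(\<lambda>(t, \<omega>). f t \<omega>) \<in> measurable (time_borel T \<Otimes>\<^sub>M P) (Lp_borel M (conj_exp p))"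
    and \<Theta>_pos: "\<And>t s. t \<in> time_set T \<Longrightarrow> s \<in> time_set T \<Longrightarrow> Lp_positive_operator M p (\<Theta> t s)"
    and \<Theta>_cont: "\<And>y t s. y \<in> Lp_space M p \<Longrightarrow> t \<in> time_set T \<Longrightarrow> s \<in> time_set T \<Longrightarrow>
        ((\<lambda>(u, r). Lp_dist M p (\<Theta> u r y) (\<Theta> t s y)) \<longlongrightarrow> 0)
          (at (t, s) within (time_set T \<times> time_set T))"
    and \<Theta>_adj: "\<And>t s. t \<in> time_set T \<Longrightarrow> s \<in> time_set T \<Longrightarrow> Lp_adjoint M p (\<Theta> t s) (\<Theta>' t s)"
    and "finite_measure q" and "sets q = sets (time_borel T)"
    and \<nu>: "\<nu> \<in> controls M p T P F"
    and \<nu>_fv: "\<And>\<omega>. \<omega> \<in> space P \<Longrightarrow> finite_variation M p T (\<nu> \<omega>)"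
    and \<rho>: "\<And>\<omega>. \<omega> \<in> space P \<Longrightarrow> variation_density M p T (\<nu> \<omega>) (\<rho> \<omega>)"
    and H: "\<And>\<omega> s. \<omega> \<in> space P \<Longrightarrow> s \<in> time_set T \<Longrightarrow>
        pointwise_integral M q (time_set T \<inter> {s..}) (\<lambda>t. \<Theta>' t s (f t \<omega>)) (H \<omega> s)"
  shows "AE \<omega> in P.
      (\<integral>\<^sup>+t. ennreal (Lp_pairing M (f t \<omega>)
          (operator_path_integral M p T (\<nu> \<omega>) (\<rho> \<omega>) t (\<Theta> t))) \<partial>q)
      = dual_path_integral M p T (\<nu> \<omega>) (\<rho> \<omega>) (H \<omega>)"
proof (rule AE_I2)
  fix \<omega> assume \<omega>: "\<omega> \<in> space P"
  have "(\<lambda>t. (t, \<omega>)) \<in> measurable (time_borel T) (time_borel T \<Otimes>\<^sub>M P)"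
    using \<omega> by simp
  from measurable_compose[OF this f_meas]
  have gm: "(\<lambda>t. f t \<omega>) \<in> measurable (time_borel T) (Lp_borel M (conj_exp p))"
    by simp
  have cont: "Lp_strongly_continuous_on M p (time_set T \<times> time_set T) (\<lambda>(t, s). \<Theta> t s)"
    using \<Theta>_cont by (auto simp: Lp_strongly_continuous_on_def case_prod_beta')
  show "(\<integral>\<^sup>+t. ennreal (Lp_pairing M (f t \<omega>)
          (operator_path_integral M p T (\<nu> \<omega>) (\<rho> \<omega>) t (\<Theta> t))) \<partial>q)
      = dual_path_integral M p T (\<nu> \<omega>) (\<rho> \<omega>) (H \<omega>)"
    by (rule operator_path_integral_duality[OF assms(1,2) \<open>finite_measure q\<close> \<open>sets q = sets (time_borel T)\<close>
          f_cone[OF _ \<omega>] gm \<Theta>_pos cont \<Theta>_adj \<nu>_fv[OF \<omega>] \<rho>[OF \<omega>] H[OF \<omega>]])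
qed

end
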